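(* Assume Martin's Axiom. Let $\mathcal{I}$ be the ideal on $\omega$ generated by the thin sets, and let $\gamma$ be an ordinal with $0<\gamma<\omega_1$. Then there exists an $\mathcal{I}$-ultrafilter $u$ on $\omega$ which belongs to the class $\mathcal{P}_\gamma$.
   Context: A set $A\subseteq\omega$ with increasing enumeration $A=\{a_n:n<\omega\}$ is thin if $\lim_{n\to\infty} a_n/a_{n+1}=0$; the thin ideal is the ideal generated by the thin sets. For an ideal $\mathcal{I}$ on $\omega$, an ultrafilter $u$ on $\omega$ is an $\mathcal{I}$-ultrafilter if for every $f\in\omega^\omega$ there is $U\in u$ with $f[U]\in\mathcal{I}$. A cascade is a tree $V$ without infinite branches with a least element $\emptyset_V$; it is sequential if every non-maximal $v\in V$ has countably infinitely many immediate successors $v^+$. Ranks: $r(v)=0$ for maximal $v$, otherwise $r(v)$ is the least ordinal greater than the ranks of all immediate successors of $v$; $r(V)=r(\emptyset_V)$. $V$ is monotone if each $v^+$ can be enumerated as $(v_n)_{n<\omega}$ with $(r(v_n))_n$ non-decreasing. For $v\in V$, $v^\uparrow$ is the subcascade consisting of $v$ and all its successors. For filters $\{\mathcal{F}_s:s\in S\}$ on $X$ and a filter $\mathcal{G}$ on $S$, $\int_{\mathcal{G}}\{\mathcal{F}_s\}=\bigcup_{G\in\mathcal{G}}\bigcap_{s\in G}\mathcal{F}_s$. The contour $\int V$ of a sequential cascade $V$ (a filter on the countable set $\max V$ of maximal elements) is defined by recursion on rank: for maximal $v$, $\int v^\uparrow$ is the principal ultrafilter at $v$; otherwise $\int v^\uparrow=\int_{\mathrm{Fr}(v^+)}\{\int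 w^\uparrow: w\in v^+\}$ where $\mathrm{Fr}(v^+)$ is the Fréchet (cofinite) filter on $v^+$; $\int V=\int\emptyset_V^\uparrow$. Identifying $\max V$ with $\omega$ (and a filter on a subset of $\omega$ with the filter on $\omega$ it generates), a monotone sequential contour of rank $\alpha$ is a filter $\int V$ with $V$ a monotone sequential cascade of rank $\alpha$ (the rank is well defined). P-hierarchy: for $1\le\alpha<\omega_1$, $u\in\mathcal{P}_\alpha$ iff $u$ contains no monotone sequential contour of rank $\alpha$ but for each $1\le\beta<\alpha$ contains some monotone sequential contour of rank $\beta$; $u\in\mathcal{P}_{\omega_1}$ if it contains monotone sequential contours of every countable rank. *)

theory Defs
  imports Complex_Main "HOL-Library.Infinite_Set" "HOL-Library.Countable_Set"
    "HOL-Library.Equipollence" HOL.Hull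
begin

section \<open>Countable ordinals\<close>

text \<open>
  The elements of this type are the countable ordinals: its order has type \<open>\<omega>\<^sub>1\<close>, the cardinal
  successor of \<open>\<omega>\<close> (see lemmas \<open>countable_initial_omega1\<close> and \<open>uncountable_omega1\<close>).
\<close>

typedef omega1 = "Field (cardSuc natLeq)"
proof -
  have "Field (cardSuc natLeq) \<noteq> {}"
    using Field_cardSuc_not_empty natLeq_Card_order by blast
  then show ?thesis by blast
qed

lemma Well_order_cardSuc_natLeq: "Well_order (cardSuc natLeq)"
  using cardSuc_Card_order natLeq_Card_order card_order_on_def by blast

instantiation omega1 :: wellorder
begin

definition less_eq_omega1 :: "omega1 \<Rightarrow> omega1 \<Rightarrow> bool" where
  "x \<le> y \<longleftrightarrow> (Rep_omega1 x, Rep_omega1 y) \<in> cardSuc natLeq"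

definition less_omega1 :: "omega1 \<Rightarrow> omega1 \<Rightarrow> bool" where
  "x < y \<longleftrightarrow> x \<le> y \<and> \<not> y \<le> x" for x y :: omega1

instance
proof
  note wo = Well_order_cardSuc_natLeq[unfolded order_on_defs]
  fix x y z :: omega1
  show "(x < y) = (x \<le> y \<and> \<not> y \<le> x)" by (rule less_omega1_def)
  show "x \<le> x"
    using wo Rep_omega1[of x] by (auto simp: less_eq_omega1_def refl_on_def)
  show "x \<le> y \<Longrightarrow> y \<le> z \<Longrightarrow> x \<le> z"
    using wo unfolding less_eq_omega1_def trans_def by blast
  show eq: "x \<le> y \<Longrightarrow> y \<le> x \<Longrightarrow> x = y" for x y :: omega1
    using wo unfolding less_eq_omega1_def antisym_def by (metis Rep_omega1_inject)
  show "x \<le> y \<or> y \<le> x"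
    using wo Rep_omega1[of x] Rep_omega1[of y]
    unfolding less_eq_omega1_def total_on_def refl_on_def by metis
  fix P :: "omega1 \<Rightarrow> bool" and a
  assume step: "\<And>x. (\<And>y. y < x \<Longrightarrow> P y) \<Longrightarrow> P x"
  have "wf (inv_image (cardSuc natLeq - Id) Rep_omega1)"
    using wo by (blast intro: wf_inv_image)
  then show "P a"
  proof (induction a rule: wf_induct_rule)
    case (less x)
    show ?case
    proof (rule step)
      fix y assume "y < x"
      then have "y \<le> x" "y \<noteq> x" unfolding less_omega1_def by auto
      then show "P y"
        using less by (auto simp: less_eq_omega1_def Rep_omega1_inject)
    qed
  qed
qed

end

instantiation omega1 :: zero
begin

definition zero_omega1 :: omega1 where
  "0 = (LEAST x :: omega1. True)"

instance ..

end

lemma zero_le_omega1: "0 \<le> (x :: omega1)"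
  unfolding zero_omega1_def by (rule Least_le) simp

lemma countable_initial_omega1: "countable {..<(a :: omega1)}"
proof -
  let ?r = "cardSuc natLeq"
  have "ordLess2 (card_of (underS ?r (Rep_omega1 a))) ?r"
    using card_of_underS[OF cardSuc_Card_order[OF natLeq_Card_order] Rep_omega1] .
  then have "ordLeq3 (card_of (underS ?r (Rep_omega1 a))) natLeq"
    using cardSuc_ordLeq_ordLess[OF natLeq_Card_order card_of_Card_order] by blast
  then have "ordLeq3 (card_of (underS ?r (Rep_omega1 a))) (card_of (UNIV :: nat set))"
    using card_of_nat ordIso_symmetric ordLeq_ordIso_trans by blast
  then have "countable (underS ?r (Rep_omega1 a))"
    unfolding card_of_ordLeq[symmetric] countable_def by blast
  moreover have "Rep_omega1 ` {..<a} \<subseteq> underS ?r (Rep_omega1 a)"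
    by (auto simp: underS_def less_omega1_def less_eq_omega1_def Rep_omega1_inject)
  ultimately have "countable (Rep_omega1 ` {..<a})"
    by (rule countable_subset[rotated])
  then show ?thesis
    by (rule countable_image_inj_on) (auto simp: inj_on_def Rep_omega1_inject)
qed

lemma uncountable_omega1: "uncountable (UNIV :: omega1 set)"
proof
  let ?r = "cardSuc natLeq"
  assume "countable (UNIV :: omega1 set)"
  then have "countable (range Rep_omega1)" by blast
  then have "countable (Field ?r)"
    using type_definition.Rep_range[OF type_definition_omega1] by simp
  then have "ordLeq3 (card_of (Field ?r)) (card_of (UNIV :: nat set))"
    unfolding card_of_ordLeq[symmetric] countable_def by blast
  then have "ordLeq3 ?r natLeq"
    using card_of_Field_ordIso[OF cardSuc_Card_order[OF natLeq_Card_order]]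
      card_of_nat ordIso_symmetric ordIso_ordLeq_trans ordLeq_ordIso_trans by blast
  then show False
    using cardSuc_greater[OF natLeq_Card_order] not_ordLess_ordLeq by blast
qed

lemma countable_bounded_omega1:
  fixes A :: "omega1 set"
  assumes "countable A"
  shows "\<exists>b. \<forall>a\<in>A. a < b"
proof (rule ccontr)
  assume "\<nexists>b. \<forall>a\<in>A. a < b"
  then have "UNIV \<subseteq> (\<Union>a\<in>A. {..<a} \<union> {a})" by (force simp: not_less le_less)
  moreover have "countable (\<Union>a\<in>A. {..<a} \<union> {a})"
    using assms countable_initial_omega1 by blast
  ultimately show False using uncountable_omega1 countable_subset by blast
qed


section \<open>Martin's Axiom\<close>

text \<open>
  A partial order is given as a relation \<open>r\<close> with carrier \<open>Field r\<close>; a pair \<open>(s, p) \<in> r\<close> means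
  that \<open>s\<close> extends \<open>p\<close>.
\<close>

definition compatible :: "'a rel \<Rightarrow> 'a \<Rightarrow> 'a \<Rightarrow> bool" where
  "compatible r p q \<longleftrightarrow> (\<exists>s. (s, p) \<in> r \<and> (s, q) \<in> r)"

definition ccc :: "'a rel \<Rightarrow> bool" where
  "ccc r \<longleftrightarrow>
     (\<forall>A \<subseteq> Field r. (\<forall>p\<in>A. \<forall>q\<in>A. p \<noteq> q \<longrightarrow> \<not> compatible r p q) \<longrightarrow> countable A)"

definition dense_in :: "'a rel \<Rightarrow> 'a set \<Rightarrow> bool" where
  "dense_in r D \<longleftrightarrow> D \<subseteq> Field r \<and> (\<forall>p \<in> Field r. \<exists>d\<in>D. (d, p) \<in> r)"

definition order_filter :: "'a rel \<Rightarrow> 'a set \<Rightarrow> bool" where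
  "order_filter r G \<longleftrightarrow>
     G \<subseteq> Field r \<and> G \<noteq> {} \<and>
     (\<forall>p\<in>G. \<forall>q. (p, q) \<in> r \<longrightarrow> q \<in> G) \<and>
     (\<forall>p\<in>G. \<forall>q\<in>G. \<exists>s\<in>G. (s, p) \<in> r \<and> (s, q) \<in> r)"

definition martins_axiom_for :: "'a rel \<Rightarrow> bool" where
  "martins_axiom_for r \<longleftrightarrow>
     (Partial_order r \<and> Field r \<noteq> {} \<and> ccc r \<longrightarrow>
       (\<forall>\<D>. \<D> \<prec> (UNIV :: nat set set) \<and> (\<forall>D\<in>\<D>. dense_in r D) \<longrightarrow>
         (\<exists>G. order_filter r G \<and> (\<forall>D\<in>\<D>. G \<inter> D \<noteq> {}))))"

text \<open>
  A formula of HOL cannot quantify over partial orders on all types. Quantifying over those on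
  one type of cardinality \<open>2\<^sup>\<omega>\<close> loses nothing: lemma \<open>martins_axiom_all\<close> below derives the axiom
  for partial orders of every type.
\<close>

definition martins_axiom :: bool where
  "martins_axiom \<longleftrightarrow> (\<forall>r :: nat set rel. martins_axiom_for r)"


lemma martins_axiom_all:
  fixes r :: "'b rel"
  assumes "martins_axiom"
  shows "martins_axiom_for r"
  unfolding martins_axiom_for_def
proof (intro impI allI)
  fix \<D>
  assume "Partial_order r \<and> Field r \<noteq> {} \<and> ccc r"
  then have po: "Partial_order r" and ne: "Field r \<noteq> {}" and ccc: "ccc r" by auto
  assume "\<D> \<prec> (UNIV :: nat set set) \<and> (\<forall>D\<in>\<D>. dense_in r D)"
  then have small: "\<D> \<prec> (UNIV :: nat set set)" and dense: "\<And>D. D \<in> \<D> \<Longrightarrow> dense_in r D" by auto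
  have tr: "(x, y) \<in> r \<Longrightarrow> (y, z) \<in> r \<Longrightarrow> (x, z) \<in> r" for x y z
    using po unfolding order_on_defs trans_def by blast
  have rf: "x \<in> Field r \<Longrightarrow> (x, x) \<in> r" for x
    using po unfolding order_on_defs refl_on_def by blast
  have as: "(x, y) \<in> r \<Longrightarrow> (y, x) \<in> r \<Longrightarrow> x = y" for x y
    using po unfolding order_on_defs antisym_def by blast
  have fd: "(x, y) \<in> r \<Longrightarrow> x \<in> Field r \<and> y \<in> Field r" for x y
    by (auto intro: FieldI1 FieldI2)
  obtain p0 where p0: "p0 \<in> Field r" using ne by blast
  have "\<forall>D p. \<exists>e. D \<in> \<D> \<and> p \<in> Field r \<longrightarrow> e \<in> D \<and> (e, p) \<in> r"
    using dense unfolding dense_in_def by blast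
  then obtain d where d: "\<And>D p. D \<in> \<D> \<Longrightarrow> p \<in> Field r \<Longrightarrow> d D p \<in> D \<and> (d D p, p) \<in> r"
    by metis
  have "\<forall>p q. \<exists>s. (compatible r p q \<longrightarrow> (s, p) \<in> r \<and> (s, q) \<in> r)
      \<and> (\<not> compatible r p q \<longrightarrow> s = p)"
    unfolding compatible_def by metis
  then obtain c where c: "\<And>p q. compatible r p q \<Longrightarrow> (c p q, p) \<in> r \<and> (c p q, q) \<in> r"
    and c': "\<And>p q. \<not> compatible r p q \<Longrightarrow> c p q = p"
    by metis
  define step where "step S = S \<union> ((\<lambda>(D, p). d D p) ` (\<D> \<times> S) \<union> (\<lambda>(p, q). c p q) ` (S \<times> S))" for S
  define S where "S n = (step ^^ n) {p0}" for n
  define P where "P = (\<Union>n. S n)"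
  have S_Suc: "S (Suc n) = step (S n)" for n by (simp add: S_def)
  have S_mono: "S m \<subseteq> S n" if "m \<le> n" for m n
    using that by (induction n rule: dec_induct) (auto simp: S_Suc step_def)
  have S_sub: "S n \<subseteq> Field r" for n
  proof (induction n)
    case 0
    then show ?case using p0 by (simp add: S_def)
  next
    case (Suc n)
    have "d D p \<in> Field r" if "D \<in> \<D>" "p \<in> S n" for D p
    proof -
      have "p \<in> Field r" using Suc that(2) by blast
      then show ?thesis using d[OF that(1)] FieldI1 by metis
    qed
    moreover have "c p q \<in> Field r" if "p \<in> S n" for p q
    proof -
      have "p \<in> Field r" using Suc that by blast
      then show ?thesis using c[of p q] c'[of p q] FieldI1 by metis
    qed
    ultimately show ?case using Suc by (auto simp: S_Suc step_def)
  qed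
  have PF: "P \<subseteq> Field r" using S_sub by (auto simp: P_def)
  have p0P: "p0 \<in> P" unfolding P_def S_def by (rule UN_I[of 0]) auto
  have Pd: "d D p \<in> P" if "D \<in> \<D>" "p \<in> P" for D p
  proof -
    obtain n where "p \<in> S n" using \<open>p \<in> P\<close> by (auto simp: P_def)
    then have "d D p \<in> S (Suc n)" using that(1) by (force simp: S_Suc step_def)
    then show ?thesis by (auto simp: P_def)
  qed
  have Pc: "c p q \<in> P" if "p \<in> P" "q \<in> P" for p q
  proof -
    obtain m n where "p \<in> S m" "q \<in> S n"
      using \<open>p \<in> P\<close> \<open>q \<in> P\<close> unfolding P_def by blast
    then have "p \<in> S (max m n)" "q \<in> S (max m n)"
      using S_mono[of m "max m n"] S_mono[of n "max m n"] by auto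
    then have "c p q \<in> S (Suc (max m n))" by (force simp: S_Suc step_def)
    then show ?thesis by (auto simp: P_def)
  qed

  let ?c = "card_of (UNIV :: nat set set)"
  have inf: "\<not> finite (UNIV :: nat set set)" by (simp add: Finite_Set.finite_set)
  have infF: "\<not> finite (Field ?c)" using inf by (simp add: Field_card_of)
  have D_le: "ordLeq3 (card_of \<D>) ?c"
    using lesspoll_imp_lepoll[OF small] unfolding lepoll_def card_of_ordLeq[symmetric] by simp
  have img: "ordLeq3 (card_of (f ` A)) ?c" if "ordLeq3 (card_of A) ?c" for f :: "'x \<Rightarrow> 'y" and A
    using that card_of_image ordLeq_transitive by blast
  have S_le: "ordLeq3 (card_of (S n)) ?c" for n
  proof (induction n)
    case 0
    then show ?case by (auto simp: S_def card_of_ordLeq[symmetric])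
  next
    case (Suc n)
    have "ordLeq3 (card_of (\<D> \<times> S n)) ?c" "ordLeq3 (card_of (S n \<times> S n)) ?c"
      using card_of_Times_ordLeq_infinite_Field[OF infF _ _ card_of_Card_order] D_le Suc by blast+
    then show ?case
      unfolding S_Suc step_def
      by (intro card_of_Un_ordLeq_infinite_Field[OF infF _ _ card_of_Card_order] Suc img)
  qed
  have "ordLeq3 (card_of P) ?c"
    unfolding P_def
    by (rule card_of_UNION_ordLeq_infinite[OF inf _ ballI[OF S_le]])
      (use infinite_iff_card_of_nat inf in blast)
  then obtain h :: "'b \<Rightarrow> nat set" where h: "inj_on h P"
    unfolding card_of_ordLeq[symmetric] by blast
  define r' where "r' = {(h p, h q) | p q. p \<in> P \<and> q \<in> P \<and> (p, q) \<in> r}"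
  have r': "(h p, h q) \<in> r' \<longleftrightarrow> (p, q) \<in> r" if "p \<in> P" "q \<in> P" for p q
    using that inj_onD[OF h] unfolding r'_def by blast
  have r'_h: "\<exists>p\<in>P. \<exists>q\<in>P. x = h p \<and> y = h q \<and> (p, q) \<in> r" if "(x, y) \<in> r'" for x y
    using that unfolding r'_def by blast
  have F': "Field r' = h ` P"
  proof
    show "Field r' \<subseteq> h ` P" unfolding r'_def Field_def by auto
    show "h ` P \<subseteq> Field r'"
    proof
      fix x assume "x \<in> h ` P"
      then obtain p where p: "p \<in> P" "x = h p" by blast
      then have "(x, x) \<in> r'" using r'[OF p(1) p(1)] rf PF by blast
      then show "x \<in> Field r'" by (rule FieldI1)
    qed
  qed
  have po': "Partial_order r'"
    unfolding order_on_defs F'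
  proof (intro conjI)
    show "r' \<subseteq> h ` P \<times> h ` P" unfolding r'_def by auto
    show "refl_on (h ` P) r'" unfolding refl_on_def using r' rf PF by auto
    show "trans r'"
    proof (rule transI)
      fix x y z assume "(x, y) \<in> r'" "(y, z) \<in> r'"
      then obtain p q q' s where "p \<in> P" "q \<in> P" "q' \<in> P" "s \<in> P" "x = h p" "y = h q" "y = h q'"
        "z = h s" "(p, q) \<in> r" "(q', s) \<in> r"
        by (meson r'_h)
      then show "(x, z) \<in> r'" using tr r' inj_onD[OF h] by metis
    qed
    show "antisym r'"
    proof (rule antisymI)
      fix x y assume xy: "(x, y) \<in> r'" and yx: "(y, x) \<in> r'"
      obtain p q where "p \<in> P" "q \<in> P" "x = h p" "y = h q" "(p, q) \<in> r"
        using r'_h[OF xy] by blast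
      then show "x = y" using yx r' as by metis
    qed
  qed
  have comp': "compatible r' (h p) (h q)" if "p \<in> P" "q \<in> P" "compatible r p q" for p q
    using c[OF that(3)] Pc[OF that(1,2)] r' that(1,2) unfolding compatible_def by blast
  have ccc': "ccc r'"
    unfolding ccc_def
  proof (intro allI impI)
    fix A assume A: "A \<subseteq> Field r'" and anti: "\<forall>p\<in>A. \<forall>q\<in>A. p \<noteq> q \<longrightarrow> \<not> compatible r' p q"
    define B where "B = {p \<in> P. h p \<in> A}"
    have "A = h ` B" using A F' unfolding B_def by auto
    moreover have "countable B"
    proof -
      have "\<not> compatible r p q" if "p \<in> B" "q \<in> B" "p \<noteq> q" for p q
      proof -
        have pq: "p \<in> P" "q \<in> P" "h p \<in> A" "h q \<in> A" using that by (auto simp: B_def)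
        then have "h p \<noteq> h q" using inj_onD[OF h] \<open>p \<noteq> q\<close> by blast
        then have "\<not> compatible r' (h p) (h q)" using anti pq(3,4) by simp
        then show ?thesis using comp'[OF pq(1,2)] by blast
      qed
      then have "\<forall>p\<in>B. \<forall>q\<in>B. p \<noteq> q \<longrightarrow> \<not> compatible r p q" by blast
      moreover have "B \<subseteq> Field r" using PF by (auto simp: B_def)
      ultimately show ?thesis using ccc unfolding ccc_def by simp
    qed
    ultimately show "countable A" by simp
  qed
  let ?\<D>' = "(\<lambda>D. h ` (D \<inter> P)) ` \<D>"
  have small': "?\<D>' \<prec> (UNIV :: nat set set)"
    using image_lepoll small by (rule lesspoll_trans1)
  have dense': "\<forall>D\<in>?\<D>'. dense_in r' D"
  proof
    fix E assume "E \<in> ?\<D>'"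
    then obtain D where D: "D \<in> \<D>" and E: "E = h ` (D \<inter> P)" by blast
    show "dense_in r' E"
      unfolding dense_in_def E F'
    proof (intro conjI ballI)
      show "h ` (D \<inter> P) \<subseteq> h ` P" by auto
      fix x assume "x \<in> h ` P"
      then obtain p where p: "p \<in> P" "x = h p" by blast
      have "d D p \<in> D \<inter> P" "(d D p, p) \<in> r" using d[OF D] Pd[OF D] p(1) PF by auto
      then show "\<exists>e\<in>h ` (D \<inter> P). (e, x) \<in> r'" using p r' by blast
    qed
  qed
  have "Field r' \<noteq> {}" using F' p0P by auto
  moreover have "martins_axiom_for r'" using assms unfolding martins_axiom_def by (rule spec)
  ultimately have "\<exists>G. order_filter r' G \<and> (\<forall>D\<in>?\<D>'. G \<inter> D \<noteq> {})"
    using po' ccc' conjI[OF small' dense'] unfolding martins_axiom_for_def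
    by (elim impE allE[of _ "?\<D>'"]) (intro conjI, assumption+)
  then obtain G' where G': "order_filter r' G'" and meets: "\<forall>D\<in>?\<D>'. G' \<inter> D \<noteq> {}"
    by (elim exE conjE)
  define G0 where "G0 = {p \<in> P. h p \<in> G'}"
  define G where "G = {q. \<exists>p\<in>G0. (p, q) \<in> r}"
  have G'_eq: "G' = h ` G0"
  proof -
    have "G' \<subseteq> h ` P" using G' F' unfolding order_filter_def by simp
    then show ?thesis unfolding G0_def by blast
  qed
  have G0P: "G0 \<subseteq> P" unfolding G0_def by auto
  have G0_G: "G0 \<subseteq> G" using G0P PF rf unfolding G_def by blast
  have dir: "\<exists>s\<in>G0. (s, p) \<in> r \<and> (s, q) \<in> r" if "p \<in> G0" "q \<in> G0" for p q
  proof -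
    have "h p \<in> G'" "h q \<in> G'" using that unfolding G0_def by auto
    then obtain x where "x \<in> G'" "(x, h p) \<in> r'" "(x, h q) \<in> r'"
      using G' unfolding order_filter_def by blast
    then obtain s where s: "s \<in> G0" "(h s, h p) \<in> r'" "(h s, h q) \<in> r'"
      unfolding G'_eq by blast
    then have "(s, p) \<in> r" "(s, q) \<in> r" using r' G0P \<open>p \<in> G0\<close> \<open>q \<in> G0\<close> by (simp_all add: subset_iff)
    then show ?thesis using s(1) by blast
  qed
  have "order_filter r G"
    unfolding order_filter_def
  proof (intro conjI ballI allI impI)
    show "G \<subseteq> Field r" using fd unfolding G_def by blast
    have "G' \<noteq> {}" using G' unfolding order_filter_def by blast
    then show "G \<noteq> {}" using G'_eq G0_G by auto
    show "q \<in> G" if "p \<in> G" "(p, q) \<in> r" for p q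
      using that tr unfolding G_def by blast
    show "\<exists>s\<in>G. (s, p) \<in> r \<and> (s, q) \<in> r" if "p \<in> G" "q \<in> G" for p q
    proof -
      obtain p' q' where pq: "p' \<in> G0" "q' \<in> G0" "(p', p) \<in> r" "(q', q) \<in> r"
        using \<open>p \<in> G\<close> \<open>q \<in> G\<close> unfolding G_def by blast
      then obtain s where "s \<in> G0" "(s, p') \<in> r" "(s, q') \<in> r" using dir by blast
      then show ?thesis using pq tr G0_G by blast
    qed
  qed
  moreover have "G \<inter> D \<noteq> {}" if "D \<in> \<D>" for D
  proof -
    obtain x where "x \<in> G'" "x \<in> h ` (D \<inter> P)" using meets \<open>D \<in> \<D>\<close> by blast
    then obtain p where "p \<in> D" "p \<in> P" "x = h p" by blast
    then have "p \<in> G0" using \<open>x \<in> G'\<close> unfolding G0_def by auto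
    then show ?thesis using \<open>p \<in> D\<close> G0_G by blast
  qed
  ultimately show "\<exists>G. order_filter r G \<and> (\<forall>D\<in>\<D>. G \<inter> D \<noteq> {})" by blast
qed


section \<open>The thin ideal and ultrafilters\<close>

definition thin :: "nat set \<Rightarrow> bool" where
  "thin A \<longleftrightarrow> infinite A \<and>
     (\<lambda>n. real (enumerate A n) / real (enumerate A (Suc n))) \<longlonglongrightarrow> 0"

definition set_ideal :: "'a set set \<Rightarrow> bool" where
  "set_ideal \<I> \<longleftrightarrow> {} \<in> \<I> \<and> (\<forall>A\<in>\<I>. \<forall>B \<subseteq> A. B \<in> \<I>) \<and> (\<forall>A\<in>\<I>. \<forall>B\<in>\<I>. A \<union> B \<in> \<I>)"

definition thin_ideal :: "nat set set" where
  "thin_ideal = set_ideal hull {A. thin A}"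

text \<open>
  Filters are the library's; a set \<open>A\<close> belongs to \<open>F\<close> if \<open>eventually (\<lambda>x. x \<in> A) F\<close>. The library
  orders filters by reverse inclusion: \<open>u \<le> F\<close> says that \<open>u\<close> contains \<open>F\<close>.
\<close>

definition ultrafilter :: "'a filter \<Rightarrow> bool" where
  "ultrafilter u \<longleftrightarrow>
     u \<noteq> bot \<and> (\<forall>A. eventually (\<lambda>x. x \<in> A) u \<or> eventually (\<lambda>x. x \<in> - A) u)"

definition ideal_ultrafilter :: "nat set set \<Rightarrow> nat filter \<Rightarrow> bool" where
  "ideal_ultrafilter \<I> u \<longleftrightarrow>
     ultrafilter u \<and> (\<forall>f :: nat \<Rightarrow> nat. \<exists>U. eventually (\<lambda>x. x \<in> U) u \<and> f ` U \<in> \<I>)"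


section \<open>Cascades\<close>

text \<open>
  A tree is given by its order relation \<open>r\<close>, with node set \<open>Field r\<close>; \<open>(v, w) \<in> r\<close> means
  \<open>v \<le> w\<close>, smaller nodes being closer to the root. Branches are maximal chains.
\<close>

definition tree_order :: "'v rel \<Rightarrow> bool" where
  "tree_order r \<longleftrightarrow>
     Partial_order r \<and> (\<forall>v \<in> Field r. well_order_on (under r v) (Restr r (under r v)))"

definition branch :: "'v rel \<Rightarrow> 'v set \<Rightarrow> bool" where
  "branch r C \<longleftrightarrow> C \<in> Chains r \<and> (\<forall>C' \<in> Chains r. C \<subseteq> C' \<longrightarrow> C' = C)"

definition least_node :: "'v rel \<Rightarrow> 'v \<Rightarrow> bool" where
  "least_node r b \<longleftrightarrow> b \<in> Field r \<and> (\<forall>v \<in> Field r. (b, v) \<in> r)"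

definition cascade :: "'v rel \<Rightarrow> bool" where
  "cascade r \<longleftrightarrow> tree_order r \<and> (\<forall>C. branch r C \<longrightarrow> finite C) \<and> (\<exists>b. least_node r b)"

definition root :: "'v rel \<Rightarrow> 'v" where
  "root r = (THE b. least_node r b)"

definition max_nodes :: "'v rel \<Rightarrow> 'v set" where
  "max_nodes r = {v \<in> Field r. aboveS r v = {}}"

definition imm_succs :: "'v rel \<Rightarrow> 'v \<Rightarrow> 'v set" where
  "imm_succs r v = {w \<in> aboveS r v. aboveS r v \<inter> underS r w = {}}"

definition sequential :: "'v rel \<Rightarrow> bool" where
  "sequential r \<longleftrightarrow>
     (\<forall>v \<in> Field r - max_nodes r. countable (imm_succs r v) \<and> infinite (imm_succs r v))"

definition succ_rel :: "'v rel \<Rightarrow> 'v rel" where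
  "succ_rel r = {(w, v). w \<in> imm_succs r v}"

text \<open>
  In a sequential cascade every rank is a countable ordinal, so the \<open>LEAST\<close> below exists
  (see lemma \<open>countable_bounded_omega1\<close>). The recursion equations are lemmas \<open>node_rank_eq\<close>
  and \<open>contour_at_eq\<close>.
\<close>

definition node_rank :: "'v rel \<Rightarrow> 'v \<Rightarrow> omega1" where
  "node_rank r = wfrec (succ_rel r) (\<lambda>rk v.
     if v \<in> max_nodes r then 0 else (LEAST \<alpha>. \<forall>w \<in> imm_succs r v. rk w < \<alpha>))"

definition cascade_rank :: "'v rel \<Rightarrow> omega1" where
  "cascade_rank r = node_rank r (root r)"

definition monotone_cascade :: "'v rel \<Rightarrow> bool" where
  "monotone_cascade r \<longleftrightarrow>
     (\<forall>v \<in> Field r - max_nodes r. \<exists>e :: nat \<Rightarrow> 'v.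
        bij_betw e UNIV (imm_succs r v) \<and> mono (\<lambda>n. node_rank r (e n)))"


section \<open>Contours\<close>

text \<open>
  Because of the reversed order, \<open>INF\<close> is the union (of a directed family) and \<open>SUP\<close> the
  intersection of filters; lemma \<open>eventually_filter_integral\<close> gives membership explicitly.
\<close>

definition filter_integral :: "'s filter \<Rightarrow> ('s \<Rightarrow> 'a filter) \<Rightarrow> 'a filter" where
  "filter_integral \<G> F = (INF G \<in> {G. eventually (\<lambda>s. s \<in> G) \<G>}. SUP s\<in>G. F s)"

lemma eventually_filter_integral:
  "eventually P (filter_integral \<G> F) \<longleftrightarrow> eventually (\<lambda>s. eventually P (F s)) \<G>"
proof -
  have "eventually P (filter_integral \<G> F) \<longleftrightarrow>
      (\<exists>G \<in> {G. eventually (\<lambda>s. s \<in> G) \<G>}. eventually P (SUP s\<in>G. F s))"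
    unfolding filter_integral_def
  proof (rule eventually_INF_base)
    show "{G. eventually (\<lambda>s. s \<in> G) \<G>} \<noteq> {}" by (auto intro: exI[of _ UNIV])
    fix A B assume "A \<in> {G. eventually (\<lambda>s. s \<in> G) \<G>}" "B \<in> {G. eventually (\<lambda>s. s \<in> G) \<G>}"
    then have "A \<inter> B \<in> {G. eventually (\<lambda>s. s \<in> G) \<G>}" by (auto intro: eventually_conj)
    then show "\<exists>C\<in>{G. eventually (\<lambda>s. s \<in> G) \<G>}. (SUP s\<in>C. F s) \<le> inf (SUP s\<in>A. F s) (SUP s\<in>B. F s)"
      by (intro bexI[of _ "A \<inter> B"]) (auto intro: SUP_subset_mono)
  qed
  also have "\<dots> \<longleftrightarrow> (\<exists>G. eventually (\<lambda>s. s \<in> G) \<G> \<and> (\<forall>s\<in>G. eventually P (F s)))"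
    by (auto simp: eventually_Sup)
  also have "\<dots> \<longleftrightarrow> eventually (\<lambda>s. eventually P (F s)) \<G>"
    by (auto elim: eventually_mono intro: exI[of _ "{s. eventually P (F s)}"])
  finally show ?thesis .
qed

definition frechet_on :: "'s set \<Rightarrow> 's filter" where
  "frechet_on S = inf cofinite (principal S)"

text \<open>\<open>contour_at r v\<close> is the contour of the subcascade of all nodes above \<open>v\<close>.\<close>

definition contour_at :: "'v rel \<Rightarrow> 'v \<Rightarrow> 'v filter" where
  "contour_at r = wfrec (succ_rel r) (\<lambda>ctr v.
     if v \<in> max_nodes r then principal {v}
     else filter_integral (frechet_on (imm_succs r v)) ctr)"

definition contour :: "'v rel \<Rightarrow> 'v filter" where
  "contour r = contour_at r (root r)"

lemma wf_succ_rel: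
  assumes "cascade r"
  shows "wf (succ_rel r)"
  unfolding wf_iff_no_infinite_down_chain
proof
  assume "\<exists>f. \<forall>i. (f (Suc i), f i) \<in> succ_rel r"
  then obtain f where f: "\<And>i. (f (Suc i), f i) \<in> succ_rel r" by blast
  have po: "trans r" "antisym r" "refl_on (Field r) r"
    using assms unfolding cascade_def tree_order_def order_on_defs by auto
  have nxt: "(f i, f (Suc i)) \<in> r" "f (Suc i) \<noteq> f i" for i
    using f[of i] unfolding succ_rel_def imm_succs_def aboveS_def by auto
  have less: "(f i, f j) \<in> r \<and> f j \<noteq> f i" if "i < j" for i j
    using that
  proof (induction rule: strict_inc_induct)
    case (base i)
    then show ?case using nxt by simp
  next
    case (step i)
    have "(f i, f j) \<in> r" using transD[OF po(1) nxt(1)[of i]] step.IH by simp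
    moreover have "f j \<noteq> f i"
    proof
      assume "f j = f i"
      then have "(f (Suc i), f i) \<in> r" using step.IH by simp
      then have "f (Suc i) = f i" by (rule antisymD[OF po(2) _ nxt(1)])
      then show False using nxt(2)[of i] by simp
    qed
    ultimately show ?case by simp
  qed
  then have "inj f" by (metis injI linorder_neqE_nat)
  then have inf: "infinite (range f)" by (simp add: finite_image_iff)
  have ch: "range f \<in> Chains r"
  proof -
    have "(f i, f j) \<in> r \<or> (f j, f i) \<in> r" for i j
      using less[of i j] less[of j i] nxt(1)[of i] po(3)
      by (cases i j rule: linorder_cases) (simp_all add: refl_on_def FieldI1)
    then show ?thesis unfolding Chains_def by blast
  qed
  let ?A = "{C \<in> Chains r. range f \<subseteq> C}"
  have "\<exists>M\<in>?A. \<forall>X\<in>?A. M \<subseteq> X \<longrightarrow> X = M"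
  proof (rule subset_Zorn_nonempty)
    show "?A \<noteq> {}" using ch by blast
    fix \<C> assume ne: "\<C> \<noteq> {}" and c: "subset.chain ?A \<C>"
    have sub: "\<C> \<subseteq> ?A" and tot: "\<And>X Y. X \<in> \<C> \<Longrightarrow> Y \<in> \<C> \<Longrightarrow> X \<subseteq> Y \<or> Y \<subseteq> X"
      using c unfolding subset_chain_def by auto
    have "(a, b) \<in> r \<or> (b, a) \<in> r" if "a \<in> X" "b \<in> Y" "X \<in> \<C>" "Y \<in> \<C>" for a b X Y
      using that sub tot[of X Y] unfolding Chains_def by blast
    then have "\<Union>\<C> \<in> Chains r" unfolding Chains_def by blast
    then show "\<Union>\<C> \<in> ?A" using ne sub by blast
  qed
  then obtain M where M: "M \<in> Chains r" "range f \<subseteq> M"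
    and max: "\<forall>X\<in>?A. M \<subseteq> X \<longrightarrow> X = M" by (elim bexE CollectE conjE)
  have "X = M" if "X \<in> Chains r" "M \<subseteq> X" for X
    using max that subset_trans[OF M(2) that(2)] by simp
  then have "branch r M" using M(1) unfolding branch_def by simp
  then have "finite M" using assms unfolding cascade_def by blast
  then show False using inf M(2) finite_subset by metis
qed

lemma node_rank_eq:
  assumes "cascade r"
  shows "node_rank r v =
    (if v \<in> max_nodes r then 0 else (LEAST \<alpha>. \<forall>w \<in> imm_succs r v. node_rank r w < \<alpha>))"
proof -
  have "cut (node_rank r) (succ_rel r) v w = node_rank r w" if "w \<in> imm_succs r v" for w
    using that by (simp add: cut_apply succ_rel_def)
  then show ?thesis
    by (subst def_wfrec[OF eq_reflection[OF node_rank_def] wf_succ_rel[OF assms]]) simp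
qed

lemma contour_at_eq:
  assumes "cascade r"
  shows "contour_at r v =
    (if v \<in> max_nodes r then principal {v}
     else filter_integral (frechet_on (imm_succs r v)) (contour_at r))"
proof -
  have cut: "cut (contour_at r) (succ_rel r) v w = contour_at r w" if "w \<in> imm_succs r v" for w
    using that by (simp add: cut_apply succ_rel_def)
  have "filter_integral (frechet_on (imm_succs r v)) (cut (contour_at r) (succ_rel r) v) =
      filter_integral (frechet_on (imm_succs r v)) (contour_at r)"
    unfolding filter_eq_iff eventually_filter_integral frechet_on_def eventually_inf_principal
    by (simp add: cut cong: imp_cong)
  then show ?thesis
    by (subst def_wfrec[OF eq_reflection[OF contour_at_def] wf_succ_rel[OF assms]]) simp
qed

text \<open>
  The injection \<open>\<phi>\<close> identifies the set of maximal nodes with a subset of \<open>\<omega>\<close>; \<open>filtermap\<close> yields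
  the filter on \<open>\<omega>\<close> generated by the image of the contour. Sequential cascades have countably many
  nodes, so it suffices to consider cascades whose nodes are natural numbers.
\<close>

definition monotone_sequential_contour :: "omega1 \<Rightarrow> nat filter \<Rightarrow> bool" where
  "monotone_sequential_contour \<alpha> F \<longleftrightarrow>
     (\<exists>(r :: nat rel) (\<phi> :: nat \<Rightarrow> nat).
        cascade r \<and> sequential r \<and> monotone_cascade r \<and> cascade_rank r = \<alpha> \<and>
        inj_on \<phi> (max_nodes r) \<and> F = filtermap \<phi> (contour r))"

definition P_class :: "omega1 \<Rightarrow> nat filter set" where
  "P_class \<alpha> = {u. ultrafilter u \<and>
     \<not> (\<exists>F. monotone_sequential_contour \<alpha> F \<and> u \<le> F) \<and>
     (\<forall>\<beta>. 0 < \<beta> \<and> \<beta> < \<alpha> \<longrightarrow> (\<exists>F. monotone_sequential_contour \<beta> F \<and> u \<le> F))}"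

end

theory Submission
  imports Defs "HOL-Library.Disjoint_Sets" "HOL-Library.Nat_Bijection" "HOL-Library.Sublist"
begin

text \<open>
  Let \<open>F\<close> be the union of an increasing sequence of contours whose ranks are cofinal below \<open>\<gamma>\<close>.
  The ultrafilter is obtained by adding to \<open>F\<close> one set for each of \<open>2\<^sup>\<omega>\<close> tasks, so that at each
  stage only a family \<open>\<B>\<close> of fewer than \<open>2\<^sup>\<omega>\<close> sets has been added.

  To make the image of \<open>f\<close> thin, observe that for each contour in the sequence and each finite
  intersection \<open>B\<close> of members of \<open>\<B>\<close> there are countably many infinite sets such that \<open>f -` Z\<close> meets
  all of the contour traced on \<open>B\<close> as soon as \<open>Z\<close> meets each of these sets infinitely often; a thin
  set \<open>Z\<close> that does this for all of them is added generically by finite approximations.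

  A contour \<open>G\<close> of rank \<open>\<gamma>\<close>, the limit of contours \<open>G\<^sub>k\<close> on disjoint sets, must not end up
  in the ultrafilter. A contour of smaller rank never contains \<open>G\<close>, and this is witnessed robustly: if \<open>G\<close>
  were contained in the filter constructed so far, then for every \<open>B\<close> there would be sets \<open>A\<^sub>k \<in> G\<^sub>k\<close>
  such that \<open>B - (\<Union>k. A'\<^sub>k)\<close> is positive whenever \<open>A'\<^sub>k \<subseteq> A\<^sub>k\<close> for almost all \<open>k\<close>. Since the sets
  of \<open>G\<^sub>k\<close> are parametrized monotonically by functions from \<open>\<omega>\<close> to \<open>\<omega>\<close>, and fewer than \<open>2\<^sup>\<omega>\<close>
  functions are eventually dominated by a single one under Martin's Axiom, one sequence \<open>A'\<close>
  serves all \<open>B\<close>, a contradiction.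
\<close>

section \<open>Contours as iterated limits\<close>

text \<open>The rank condition at an inner node of a monotone cascade whose immediate successors
  have the ranks \<open>a n\<close>. If \<open>\<alpha>\<close> is a successor ordinal,
  \<open>a\<close> is eventually constant; if it is a limit, \<open>a\<close> is cofinal in
  it.\<close>

definition least_strict_bound :: "(nat \<Rightarrow> omega1) \<Rightarrow> omega1 \<Rightarrow> bool" where
  "least_strict_bound a \<alpha> \<longleftrightarrow> mono a \<and> (\<forall>n. a n < \<alpha>) \<and> (\<forall>\<beta><\<alpha>. \<exists>n. \<beta> \<le> a n)"

text \<open>A contour freed from its tree: \<open>D\<close> is the set of points attached to the
  leaves, and numbering the immediate successors of the root turns their Frechet filter into
  \<open>sequentially\<close>. Inductions on contours run over this predicate;
  \<open>contour_on_contour\<close> and \<open>monotone_sequential_contour_of_contour_on\<close>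
  translate from and to cascades.\<close>

inductive contour_on :: "omega1 \<Rightarrow> nat set \<Rightarrow> nat filter \<Rightarrow> bool" where
  point: "contour_on 0 {x} (principal {x})"
| lim: "\<lbrakk>\<And>n. contour_on (a n) (D n) (F n); disjoint_family D; least_strict_bound a \<alpha>\<rbrakk>
    \<Longrightarrow> contour_on \<alpha> (\<Union>n. D n) (filter_integral sequentially F)"

lemma frequently_lim:
  "(\<exists>\<^sub>F x in filter_integral sequentially F. P x) \<longleftrightarrow> (\<forall>m. \<exists>n\<ge>m. \<exists>\<^sub>F x in F n. P x)"
  unfolding frequently_def eventually_filter_integral eventually_sequentially by auto

lemma least_strict_boundD:
  assumes "least_strict_bound a \<alpha>"
  shows "mono a" "a n < \<alpha>" "\<beta> < \<alpha> \<Longrightarrow> \<exists>n. \<beta> \<le> a n"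
  using assms unfolding least_strict_bound_def by auto

lemma least_strict_bound_eventually:
  assumes "least_strict_bound a \<alpha>" "\<beta> < \<alpha>"
  shows "\<exists>m. \<forall>n\<ge>m. \<beta> \<le> a n"
  using least_strict_boundD[OF assms(1)] assms(2) by (meson monoD order_trans)

lemma not_less_zero_omega1: "\<not> (x :: omega1) < 0"
  using zero_le_omega1[of x] by simp

lemma zero_less_omega1: "x \<noteq> 0 \<Longrightarrow> 0 < (x :: omega1)"
  using zero_le_omega1[of x] by (simp add: order.strict_iff_order)

lemma contour_on_zeroD:
  assumes "contour_on 0 D F"
  shows "\<exists>x. D = {x} \<and> F = principal {x}"
  using assms by cases (auto simp: least_strict_bound_def not_less_zero_omega1)

lemma contour_on_posE:
  assumes "contour_on \<alpha> D F" "0 < \<alpha>"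
  obtains a E G where "\<And>n. contour_on (a n) (E n) (G n)" "disjoint_family E"
    "least_strict_bound a \<alpha>" "D = (\<Union>n. E n)" "F = filter_integral sequentially G"
  using assms by (cases rule: contour_on.cases) auto

lemma contour_on_eventually: "contour_on \<alpha> D F \<Longrightarrow> eventually (\<lambda>x. x \<in> D) F"
proof (induction rule: contour_on.induct)
  case (lim a D F \<alpha>)
  have "eventually (\<lambda>x. x \<in> (\<Union>n. D n)) (F n)" for n
    using lim.IH[of n] by (rule eventually_mono) blast
  then show ?case by (simp add: eventually_filter_integral)
qed (simp add: eventually_principal)

lemma contour_on_neq_bot: "contour_on \<alpha> D F \<Longrightarrow> F \<noteq> bot"
  by (induction rule: contour_on.induct)
    (auto simp: trivial_limit_def eventually_filter_integral eventually_principal)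

section \<open>Contours do not contain contours of higher rank\<close>

lemma frequently_disj_iff_Diff:
  "(\<exists>\<^sub>F x in F. x \<in> B) \<longleftrightarrow> (\<exists>\<^sub>F x in F. x \<in> B \<inter> A) \<or> (\<exists>\<^sub>F x in F. x \<in> B - A)"
  unfolding frequently_disj_iff[symmetric] by (rule arg_cong[where f = "\<lambda>P. frequently P F"]) auto

lemma frequently_subset: "(\<exists>\<^sub>F x in F. x \<in> A) \<Longrightarrow> A \<subseteq> B \<Longrightarrow> \<exists>\<^sub>F x in F. x \<in> B"
  by (auto elim: frequently_elim1)

lemma frequently_Diff_UN:
  fixes K :: nat
  assumes "\<exists>\<^sub>F x in F. x \<in> B" "\<And>k. k < K \<Longrightarrow> \<not> (\<exists>\<^sub>F x in F. x \<in> B \<inter> E k)"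
  shows "\<exists>\<^sub>F x in F. x \<in> B - (\<Union>k<K. E k)"
  using assms(2)
proof (induction K)
  case (Suc K)
  have "\<exists>\<^sub>F x in F. x \<in> B - (\<Union>k<K. E k)" using Suc by simp
  moreover have "\<not> (\<exists>\<^sub>F x in F. x \<in> (B - (\<Union>k<K. E k)) \<inter> E K)"
    using Suc.prems[of K] frequently_subset[of _ F "B \<inter> E K"] by blast
  ultimately have "\<exists>\<^sub>F x in F. x \<in> (B - (\<Union>k<K. E k)) - E K"
    using frequently_disj_iff_Diff by metis
  then show ?case by (rule frequently_subset) (auto simp: lessThan_Suc)
qed (use assms in auto)

text \<open>If sets \<open>B \<inter> E k\<close> are positive for \<open>F n\<close> with both
  indices arbitrarily large, \<open>hyp\<close> is applied to a sequence of such single pieces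
  \<open>G k\<close>. Otherwise almost all pieces are null on \<open>B\<close> for almost all
  \<open>F n\<close>; then \<open>hyp\<close> is applied to the whole limit of \<open>G\<close>, and
  the sets obtained for the various \<open>n\<close> are combined diagonally. The quantifier over
  all \<open>A'\<close> that lie below \<open>A\<close> almost everywhere later allows one sequence
  to serve many sets \<open>B\<close>.\<close>

lemma escape_lim:
  fixes F :: "nat \<Rightarrow> nat filter"
  assumes hyp: "\<forall>n \<beta> E G B. contour_on \<beta> E G \<longrightarrow> \<alpha> \<le> \<beta> \<longrightarrow> (\<exists>\<^sub>F x in F n. x \<in> B) \<longrightarrow>
      (\<exists>A. eventually (\<lambda>x. x \<in> A) G \<and> (\<exists>\<^sub>F x in F n. x \<in> B - A))"
    and G: "\<And>k. contour_on (b k) (E k) (G k)" and E: "disjoint_family E"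
    and b: "least_strict_bound b \<beta>" and \<alpha>: "\<alpha> < \<beta>"
    and pos: "\<And>K. \<exists>\<^sub>F x in filter_integral sequentially F. x \<in> B - (\<Union>k<K. E k)"
  shows "\<exists>A. (\<forall>k. eventually (\<lambda>x. x \<in> A k) (G k)) \<and>
    (\<forall>A'. (\<forall>k. A' k \<subseteq> E k) \<and> (\<exists>m. \<forall>k\<ge>m. A' k \<subseteq> A k) \<longrightarrow>
      (\<exists>\<^sub>F x in filter_integral sequentially F. x \<in> B - (\<Union>k. A' k)))"
proof -
  obtain k0 where k0: "\<And>k. k \<ge> k0 \<Longrightarrow> \<alpha> \<le> b k"
    using least_strict_bound_eventually[OF b \<alpha>] by blast
  define P where "P n k \<longleftrightarrow> (\<exists>\<^sub>F x in F n. x \<in> B \<inter> E k)" for n k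
  show ?thesis
  proof (cases "\<forall>K. \<exists>n\<ge>K. \<exists>k\<ge>K. P n k")
    case True
    \<comment> \<open>The pairs increase in both indices, so that the filters \<open>F n\<close> are
      cofinal and no piece is used twice. The bound \<open>k0\<close> gives the piece rank at least
      \<open>\<alpha>\<close>, as \<open>hyp\<close> demands.\<close>
    have "\<exists>s :: nat \<Rightarrow> nat \<times> nat. \<forall>j. (P (fst (s j)) (snd (s j)) \<and> k0 \<le> snd (s j)) \<and>
        fst (s j) < fst (s (Suc j)) \<and> snd (s j) < snd (s (Suc j))"
    proof (rule dependent_nat_choice)
      show "\<exists>p. P (fst p) (snd p) \<and> k0 \<le> snd p"
        using True[rule_format, of k0] by auto
      fix p :: "nat \<times> nat"
      obtain n k where "n \<ge> Suc (k0 + fst p + snd p)" "k \<ge> Suc (k0 + fst p + snd p)" "P n k"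
        using True by blast
      then show "\<exists>q. (P (fst q) (snd q) \<and> k0 \<le> snd q) \<and> fst p < fst q \<and> snd p < snd q"
        by (intro exI[of _ "(n, k)"]) auto
    qed
    then obtain s where "\<forall>j. (P (fst (s j)) (snd (s j)) \<and> k0 \<le> snd (s j)) \<and>
        fst (s j) < fst (s (Suc j)) \<and> snd (s j) < snd (s (Suc j))" by blast
    moreover define nn kk where "nn j = fst (s j)" and "kk j = snd (s j)" for j
    ultimately have P: "\<And>j. P (nn j) (kk j)" and kk0: "\<And>j. k0 \<le> kk j"
      and mono: "strict_mono nn" "strict_mono kk"
      by (auto simp: strict_mono_Suc_iff)
    have "\<forall>j. \<exists>C. eventually (\<lambda>x. x \<in> C) (G (kk j)) \<and> (\<exists>\<^sub>F x in F (nn j). x \<in> B \<inter> E (kk j) - C)"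
      using hyp[rule_format, OF G] k0[OF kk0] P unfolding P_def by blast
    then obtain C where C: "\<And>j. eventually (\<lambda>x. x \<in> C j) (G (kk j))"
      "\<And>j. \<exists>\<^sub>F x in F (nn j). x \<in> B \<inter> E (kk j) - C j" by metis
    \<comment> \<open>Pieces that were not selected impose no constraint, hence
      \<open>UNIV\<close>.\<close>
    define A where "A k = (if k \<in> range kk then C (inv kk k) else UNIV)" for k
    have Akk: "A (kk j) = C j" for j
      using strict_mono_imp_inj_on[OF mono(2)] by (simp add: A_def)
    have "eventually (\<lambda>x. x \<in> A k) (G k)" for k
      using C(1) strict_mono_imp_inj_on[OF mono(2)] by (auto simp: A_def)
    moreover have "\<exists>\<^sub>F x in filter_integral sequentially F. x \<in> B - (\<Union>k. A' k)"
      if A': "\<And>k. A' k \<subseteq> E k" and sub: "\<And>k. k \<ge> m \<Longrightarrow> A' k \<subseteq> A k" for A' m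
      unfolding frequently_lim
    proof
      fix l
      define j where "j = l + m"
      have "j \<le> nn j" "j \<le> kk j" using mono strict_mono_imp_increasing by blast+
      then have jl: "l \<le> nn j" "m \<le> kk j" by (auto simp: j_def)
      \<comment> \<open>By disjointness only the set with index \<open>kk j\<close> meets
        \<open>E (kk j)\<close>.\<close>
      have "A' k \<inter> E (kk j) \<subseteq> C j" for k
        using A'[of k] sub[OF jl(2)] disjoint_family_onD[OF E, of k "kk j"]
        by (cases "k = kk j") (auto simp: Akk)
      then have "B \<inter> E (kk j) - C j \<subseteq> B - (\<Union>k. A' k)" by blast
      then show "\<exists>n\<ge>l. \<exists>\<^sub>F x in F n. x \<in> B - (\<Union>k. A' k)"
        using C(2)[of j] jl(1) frequently_subset by blast
    qed
    ultimately show ?thesis by (intro exI[of _ A]) blast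
  next
    case False
    then obtain K where K: "\<And>n k. n \<ge> K \<Longrightarrow> k \<ge> K \<Longrightarrow> \<not> P n k" by blast
    \<comment> \<open>On \<open>B'\<close> every piece \<open>E k\<close> is null for
      \<open>F n\<close> with \<open>n \<ge> K\<close>: if \<open>k < K\<close> it has been removed,
      otherwise by the choice of \<open>K\<close>.\<close>
    define B' where "B' = B - (\<Union>k<K. E k)"
    define N where "N = {n. n \<ge> K \<and> (\<exists>\<^sub>F x in F n. x \<in> B')}"
    have N: "\<exists>n\<in>N. n \<ge> l" for l
      using pos[of K, unfolded frequently_lim, rule_format, of "max l K"]
      by (auto simp: N_def B'_def)
    have limG: "contour_on \<beta> (\<Union>k. E k) (filter_integral sequentially G)"
      using contour_on.lim[OF G E b] .
    have "\<forall>n. \<exists>C. n \<in> N \<longrightarrow> eventually (\<lambda>x. x \<in> C) (filter_integral sequentially G) \<and>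
        (\<exists>\<^sub>F x in F n. x \<in> B' - C)"
      using hyp[rule_format, OF limG less_imp_le[OF \<alpha>]] by (simp add: N_def)
    then obtain C where C: "\<And>n. n \<in> N \<Longrightarrow> eventually (\<lambda>x. x \<in> C n) (filter_integral sequentially G)"
      "\<And>n. n \<in> N \<Longrightarrow> \<exists>\<^sub>F x in F n. x \<in> B' - C n" by metis
    have "\<forall>n. \<exists>l. n \<in> N \<longrightarrow> (\<forall>k\<ge>l. eventually (\<lambda>x. x \<in> C n) (G k))"
      using C(1) unfolding eventually_filter_integral eventually_sequentially by blast
    then obtain l where l: "\<And>n k. n \<in> N \<Longrightarrow> k \<ge> l n \<Longrightarrow> eventually (\<lambda>x. x \<in> C n) (G k)"
      by metis
    \<comment> \<open>A diagonal intersection: finitely many sets for each \<open>k\<close>, so it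
      stays in \<open>G k\<close>, yet for fixed \<open>n\<close> in \<open>N\<close> it lies inside
      \<open>C n\<close> for all large \<open>k\<close>.\<close>
    define A where "A k = (\<Inter>n\<in>{n\<in>N. n \<le> k \<and> l n \<le> k}. C n)" for k
    have "eventually (\<lambda>x. x \<in> A k) (G k)" for k
    proof -
      have "finite {n\<in>N. n \<le> k \<and> l n \<le> k}" by (rule finite_subset[of _ "{..k}"]) auto
      then have "eventually (\<lambda>x. \<forall>n\<in>{n\<in>N. n \<le> k \<and> l n \<le> k}. x \<in> C n) (G k)"
        using l by (intro eventually_ball_finite) auto
      then show ?thesis by (rule eventually_mono) (auto simp: A_def)
    qed
    moreover have "\<exists>\<^sub>F x in filter_integral sequentially F. x \<in> B - (\<Union>k. A' k)"
      if A': "\<And>k. A' k \<subseteq> E k" and sub: "\<And>k. k \<ge> m \<Longrightarrow> A' k \<subseteq> A k" for A' m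
      unfolding frequently_lim
    proof
      fix i
      obtain n where n: "n \<in> N" "n \<ge> i" using N by blast
      \<comment> \<open>From \<open>M\<close> on, \<open>A' k\<close> lies in \<open>C n\<close>;
        the earlier ones lie in finitely many null pieces, which are removed entirely.\<close>
      define M where "M = max m (max n (l n))"
      have "\<not> (\<exists>\<^sub>F x in F n. x \<in> (B' - C n) \<inter> E k)" for k
      proof (cases "k < K")
        case True
        then have "(B' - C n) \<inter> E k = {}" by (auto simp: B'_def)
        then show ?thesis by simp
      next
        case False
        then have "\<not> (\<exists>\<^sub>F x in F n. x \<in> B \<inter> E k)"
          using K[of n k] n(1) by (simp add: P_def N_def)
        moreover have "(B' - C n) \<inter> E k \<subseteq> B \<inter> E k" by (auto simp: B'_def)
        ultimately show ?thesis using frequently_subset by metis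
      qed
      then have "\<exists>\<^sub>F x in F n. x \<in> (B' - C n) - (\<Union>k<M. E k)"
        using frequently_Diff_UN[OF C(2)[OF n(1)]] by blast
      moreover have "(B' - C n) - (\<Union>k<M. E k) \<subseteq> B - (\<Union>k. A' k)"
      proof -
        have "A' k \<subseteq> C n" if "k \<ge> M" for k
        proof -
          have "A' k \<subseteq> A k" "n \<le> k \<and> l n \<le> k" using that sub[of k] by (simp_all add: M_def)
          then show ?thesis using n(1) by (auto simp: A_def)
        qed
        moreover have "A' k \<subseteq> (\<Union>k<M. E k)" if "k < M" for k using that A'[of k] by auto
        ultimately have "A' k \<subseteq> C n \<union> (\<Union>k<M. E k)" for k
          by (cases "k < M") (simp_all add: le_supI1 le_supI2 not_less)
        then show ?thesis unfolding B'_def by blast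
      qed
      ultimately show "\<exists>n\<ge>i. \<exists>\<^sub>F x in F n. x \<in> B - (\<Union>k. A' k)"
        using n(2) frequently_subset by blast
    qed
    ultimately show ?thesis by (intro exI[of _ A]) blast
  qed
qed

text \<open>Induction on the construction of \<open>F\<close>, for all contours \<open>G\<close> of
  higher rank and all \<open>B\<close> at once. A contour of positive rank contains the complement
  of every point. In the limit case \<open>a n < \<alpha>\<close> turns the induction hypothesis
  into the hypothesis of \<open>escape_lim\<close>; if finitely many pieces of \<open>G\<close>
  already carry \<open>B\<close> up to a null set, the complement of these pieces is the
  witness.\<close>

lemma contour_not_finer:
  assumes "contour_on \<alpha> D F" "contour_on \<beta> E G" "\<alpha> < \<beta>" "\<exists>\<^sub>F x in F. x \<in> B"
  shows "\<exists>A. eventually (\<lambda>x. x \<in> A) G \<and> (\<exists>\<^sub>F x in F. x \<in> B - A)"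
  using assms
proof (induction arbitrary: \<beta> E G B rule: contour_on.induct)
  case (point x)
  then have "0 < \<beta>" by simp
  obtain b E' G' where G: "\<And>k. contour_on (b k) (E' k) (G' k)"
    and E: "disjoint_family E'" and b: "least_strict_bound b \<beta>"
    and G': "G = filter_integral sequentially G'"
    using contour_on_posE[OF point(1) \<open>0 < \<beta>\<close>] by metis
  have "eventually (\<lambda>y. y \<noteq> x) G"
  proof (cases "\<exists>k. x \<in> E' k")
    case True
    then obtain k where k: "x \<in> E' k" by blast
    have "eventually (\<lambda>y. y \<noteq> x) (G' j)" if "j > k" for j
      using contour_on_eventually[OF G[of j]]
      by (rule eventually_mono) (use k disjoint_family_onD[OF E, of j k] that in auto)
    then show ?thesis
      unfolding G' eventually_filter_integral eventually_sequentially by (meson Suc_le_lessD)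
  next
    case False
    have "eventually (\<lambda>y. y \<noteq> x) (G' j)" for j
      using contour_on_eventually[OF G[of j]] by (rule eventually_mono) (use False in auto)
    then show ?thesis unfolding G' eventually_filter_integral by simp
  qed
  then show ?case
    using point(3) by (intro exI[of _ "- {x}"]) (auto simp: frequently_def eventually_principal)
next
  case (lim a D F \<alpha>)
  have "0 < \<beta>" using lim.prems(2) zero_le_omega1 le_less_trans by blast
  obtain b E' G' where G: "\<And>k. contour_on (b k) (E' k) (G' k)"
    and E: "disjoint_family E'" and b: "least_strict_bound b \<beta>"
    and G': "G = filter_integral sequentially G'"
    using contour_on_posE[OF lim.prems(1) \<open>0 < \<beta>\<close>] by metis
  show ?case
  proof (cases "\<forall>K. \<exists>\<^sub>F x in filter_integral sequentially F. x \<in> B - (\<Union>k<K. E' k)")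
    case True
    have "\<forall>n \<delta> C H B. contour_on \<delta> C H \<longrightarrow> \<alpha> \<le> \<delta> \<longrightarrow> (\<exists>\<^sub>F x in F n. x \<in> B) \<longrightarrow>
        (\<exists>A. eventually (\<lambda>x. x \<in> A) H \<and> (\<exists>\<^sub>F x in F n. x \<in> B - A))"
      using lim.IH least_strict_boundD(2)[OF lim.hyps(3)] less_le_trans by blast
    from escape_lim[where F = F, OF this G E b lim.prems(2) True[rule_format]] obtain A where
      A: "\<forall>k. eventually (\<lambda>x. x \<in> A k) (G' k)" and
      esc: "\<forall>A'. (\<forall>k. A' k \<subseteq> E' k) \<and> (\<exists>m. \<forall>k\<ge>m. A' k \<subseteq> A k) \<longrightarrow>
        (\<exists>\<^sub>F x in filter_integral sequentially F. x \<in> B - (\<Union>k. A' k))"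
      by (elim exE conjE)
    have "eventually (\<lambda>x. x \<in> (\<Union>k. A k \<inter> E' k)) (G' k)" for k
      using A[rule_format, of k] contour_on_eventually[OF G[of k]] by eventually_elim blast
    then have "eventually (\<lambda>x. x \<in> (\<Union>k. A k \<inter> E' k)) G"
      unfolding G' eventually_filter_integral by simp
    moreover have "\<exists>\<^sub>F x in filter_integral sequentially F. x \<in> B - (\<Union>k. A k \<inter> E' k)"
      by (rule esc[rule_format]) auto
    ultimately show ?thesis by blast
  next
    case False
    then obtain K where K: "\<not> (\<exists>\<^sub>F x in filter_integral sequentially F. x \<in> B - (\<Union>k<K. E' k))"
      by blast
    have "eventually (\<lambda>x. x \<notin> (\<Union>k<K. E' k)) (G' j)" if "j \<ge> K" for j
      using contour_on_eventually[OF G[of j]]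
    proof (rule eventually_mono)
      fix x assume "x \<in> E' j"
      moreover have "E' j \<inter> E' k = {}" if "k < K" for k
        using disjoint_family_onD[OF E, of j k] that \<open>j \<ge> K\<close> by auto
      ultimately show "x \<notin> (\<Union>k<K. E' k)" by blast
    qed
    then have "eventually (\<lambda>x. x \<in> - (\<Union>k<K. E' k)) G"
      unfolding G' eventually_filter_integral eventually_sequentially by auto
    moreover have "\<exists>\<^sub>F x in filter_integral sequentially F. x \<in> B - - (\<Union>k<K. E' k)"
      using K lim.prems(3) frequently_disj_iff_Diff[of B _ "- (\<Union>k<K. E' k)"]
      by (simp add: Diff_eq)
    ultimately show ?thesis by blast
  qed
qed

text \<open>The robust form of \<open>contour_not_finer\<close>. That lemma, applied to the filters
  one level below \<open>F\<close>, supplies the hypothesis of \<open>escape_lim\<close>.\<close>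

lemma escape:
  assumes F: "contour_on \<alpha> D F"
    and G: "\<And>k. contour_on (b k) (E k) (G k)" and E: "disjoint_family E"
    and b: "least_strict_bound b \<beta>" and \<alpha>: "\<alpha> < \<beta>"
    and pos: "\<And>K. \<exists>\<^sub>F x in F. x \<in> B - (\<Union>k<K. E k)"
  shows "\<exists>A. (\<forall>k. eventually (\<lambda>x. x \<in> A k) (G k)) \<and>
    (\<forall>A'. (\<forall>k. A' k \<subseteq> E k) \<and> (\<exists>m. \<forall>k\<ge>m. A' k \<subseteq> A k) \<longrightarrow>
      (\<exists>\<^sub>F x in F. x \<in> B - (\<Union>k. A' k)))"
  using F
proof cases
  case (point x)
  have x: "x \<in> B - (\<Union>k<K. E k)" for K
    using pos[of K] unfolding point frequently_def eventually_principal by auto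
  \<comment> \<open>The point lies outside all pieces, so no choice of \<open>A'\<close> can remove
    it.\<close>
  then have "x \<notin> E k" for k using x[of "Suc k"] by auto
  then show ?thesis
    using x by (intro exI[of _ "\<lambda>_. UNIV"])
      (auto simp: point frequently_def eventually_principal subset_iff)
next
  case (lim a D' F')
  have "\<forall>n \<delta> C H B. contour_on \<delta> C H \<longrightarrow> \<alpha> \<le> \<delta> \<longrightarrow> (\<exists>\<^sub>F x in F' n. x \<in> B) \<longrightarrow>
      (\<exists>A. eventually (\<lambda>x. x \<in> A) H \<and> (\<exists>\<^sub>F x in F' n. x \<in> B - A))"
    using contour_not_finer[OF lim(3)] least_strict_boundD(2)[OF lim(5)] less_le_trans by blast
  from escape_lim[where F = F', OF this G E b \<alpha> pos[unfolded lim(2)]] show ?thesis unfolding lim(2) .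
qed

section \<open>Countable families that test the positivity of preimages\<close>

text \<open>If infinitely many \<open>F n\<close> have such a family, the union of one family for
  each of them works. Otherwise, by the induction hypothesis, \<open>f\<close> takes on
  \<open>B\<close> only finitely many values modulo \<open>F n\<close> for all large
  \<open>n\<close>, and a single test set suffices: infinitely many distinct values, taken on
  positive parts of \<open>B\<close> for ever larger \<open>n\<close>.\<close>

lemma countable_test_family:
  assumes "contour_on \<alpha> D F" "\<And>M. finite M \<Longrightarrow> \<exists>\<^sub>F x in F. x \<in> B \<and> f x \<notin> M"
  shows "\<exists>\<E>. countable \<E> \<and> (\<forall>E\<in>\<E>. infinite E) \<and>
    (\<forall>Z. (\<forall>E\<in>\<E>. infinite (Z \<inter> E)) \<longrightarrow> (\<exists>\<^sub>F x in F. x \<in> B \<and> f x \<in> Z))"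
  using assms
proof (induction rule: contour_on.induct)
  case (point x)
  then show ?case
    by (auto simp: frequently_def eventually_principal dest: spec[of _ "{f x}"])
next
  case (lim a D F \<alpha>)
  define Q where "Q n \<E> \<longleftrightarrow> countable \<E> \<and> (\<forall>E\<in>\<E>. infinite E) \<and>
    (\<forall>Z. (\<forall>E\<in>\<E>. infinite (Z \<inter> E)) \<longrightarrow> (\<exists>\<^sub>F x in F n. x \<in> B \<and> f x \<in> Z))" for n \<E>
  show ?case
  proof (cases "\<forall>m. \<exists>n\<ge>m. \<exists>\<E>. Q n \<E>")
    case True
    define \<E> where "\<E> n = (SOME \<E>. Q n \<E>)" for n
    define N where "N = {n. \<exists>\<E>. Q n \<E>}"
    have Q: "Q n (\<E> n)" if "n \<in> N" for n
      using that unfolding N_def \<E>_def by (auto intro: someI_ex)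
    have "countable (\<Union>n\<in>N. \<E> n)" using Q unfolding Q_def by auto
    moreover have "\<forall>E\<in>(\<Union>n\<in>N. \<E> n). infinite E" using Q unfolding Q_def by blast
    moreover have "\<exists>\<^sub>F x in filter_integral sequentially F. x \<in> B \<and> f x \<in> Z"
      if "\<forall>E\<in>(\<Union>n\<in>N. \<E> n). infinite (Z \<inter> E)" for Z
      unfolding frequently_lim
    proof
      fix m
      obtain n where n: "n \<ge> m" "n \<in> N" using True unfolding N_def by blast
      then have "\<exists>\<^sub>F x in F n. x \<in> B \<and> f x \<in> Z" using Q[OF n(2)] that unfolding Q_def by blast
      with n(1) show "\<exists>n\<ge>m. \<exists>\<^sub>F x in F n. x \<in> B \<and> f x \<in> Z" by blast
    qed
    ultimately show ?thesis by (intro exI[of _ "\<Union>n\<in>N. \<E> n"]) blast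
  next
    case False
    then obtain m0 where "\<And>n \<E>. n \<ge> m0 \<Longrightarrow> \<not> Q n \<E>" by blast
    then have ex: "\<exists>M. finite M \<and> \<not> (\<exists>\<^sub>F x in F n. x \<in> B \<and> f x \<notin> M)" if "n \<ge> m0" for n
      using lim.IH[of n] that unfolding Q_def by blast
    have step: "\<exists>n\<ge>l. \<exists>m. m \<notin> M \<and> (\<exists>\<^sub>F x in F n. x \<in> B \<and> f x \<in> {m})" if M: "finite M" for l M
    proof -
      obtain n where n: "n \<ge> max l m0" "\<exists>\<^sub>F x in F n. x \<in> B \<and> f x \<notin> M"
        using lim.prems[OF M, unfolded frequently_lim] by blast
      obtain M' where M': "finite M'" "\<not> (\<exists>\<^sub>F x in F n. x \<in> B \<and> f x \<notin> M')"
        using ex[of n] n(1) by auto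
      \<comment> \<open>Otherwise each of the finitely many values in \<open>M' - M\<close> is taken
        on a null part of \<open>B\<close>, so that almost all of \<open>B\<close> is mapped into
        \<open>M\<close>, against the choice of \<open>n\<close>.\<close>
      have "\<exists>m\<in>M' - M. \<exists>\<^sub>F x in F n. x \<in> B \<and> f x = m"
      proof (rule ccontr)
        assume "\<not> ?thesis"
        then have "\<forall>m\<in>M' - M. eventually (\<lambda>x. \<not> (x \<in> B \<and> f x = m)) (F n)"
          by (simp add: not_frequently)
        then have "eventually (\<lambda>x. \<forall>m\<in>M' - M. \<not> (x \<in> B \<and> f x = m)) (F n)"
          using M'(1) by (intro eventually_ball_finite) auto
        moreover have "eventually (\<lambda>x. \<not> (x \<in> B \<and> f x \<notin> M')) (F n)"
          using M'(2) by (simp add: not_frequently)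
        ultimately have "eventually (\<lambda>x. \<not> (x \<in> B \<and> f x \<notin> M)) (F n)"
          by eventually_elim auto
        then show False using n(2) by (simp add: frequently_def)
      qed
      then show ?thesis using n(1) by auto
    qed
    define V where "V l = {m. \<exists>n\<ge>l. \<exists>\<^sub>F x in F n. x \<in> B \<and> f x \<in> {m}}" for l
    \<comment> \<open>A state has the form \<open>((l, M), m)\<close>: the new value
      \<open>m\<close> belongs to \<open>V l\<close>, and \<open>M\<close> collects the values used
      before.\<close>
    have "\<exists>s :: nat \<Rightarrow> (nat \<times> 'a set) \<times> 'a. \<forall>j.
        (finite (snd (fst (s j))) \<and> snd (s j) \<notin> snd (fst (s j)) \<and> snd (s j) \<in> V (fst (fst (s j)))) \<and>
        fst (fst (s j)) < fst (fst (s (Suc j))) \<and>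
        snd (fst (s (Suc j))) = insert (snd (s j)) (snd (fst (s j)))"
    proof (rule dependent_nat_choice)
      show "\<exists>p :: (nat \<times> 'a set) \<times> 'a. finite (snd (fst p)) \<and> snd p \<notin> snd (fst p) \<and> snd p \<in> V (fst (fst p))"
        using step[of "{}" 0] unfolding V_def by auto
      fix p :: "(nat \<times> 'a set) \<times> 'a" and j :: nat
      assume "finite (snd (fst p)) \<and> snd p \<notin> snd (fst p) \<and> snd p \<in> V (fst (fst p))"
      then have "finite (insert (snd p) (snd (fst p)))" by simp
      from step[OF this, of "Suc (fst (fst p))"]
      obtain m where "m \<notin> insert (snd p) (snd (fst p))" "m \<in> V (Suc (fst (fst p)))"
        unfolding V_def by blast
      then show "\<exists>q :: (nat \<times> 'a set) \<times> 'a. (finite (snd (fst q)) \<and> snd q \<notin> snd (fst q) \<and> snd q \<in> V (fst (fst q))) \<and>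
          fst (fst p) < fst (fst q) \<and> snd (fst q) = insert (snd p) (snd (fst p))"
        using \<open>finite (insert _ _)\<close>
        by (intro exI[of _ "((Suc (fst (fst p)), insert (snd p) (snd (fst p))), m)"]) auto
    qed
    then obtain s where s: "\<And>j. snd (s j) \<notin> snd (fst (s j))" "\<And>j. snd (s j) \<in> V (fst (fst (s j)))"
      "\<And>j. fst (fst (s j)) < fst (fst (s (Suc j)))"
      "\<And>j. snd (fst (s (Suc j))) = insert (snd (s j)) (snd (fst (s j)))" by blast
    define v where "v j = snd (s j)" for j
    have mem: "v i \<in> snd (fst (s j))" if "i < j" for i j
      using that by (induction j) (auto simp: s(4) v_def less_Suc_eq)
    have inj: "inj v" unfolding inj_def
      by (metis mem s(1) v_def linorder_neqE_nat)
    have sm: "strict_mono (\<lambda>j. fst (fst (s j)))" using s(3) by (simp add: strict_mono_Suc_iff)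
    have vV: "v j \<in> V l" if "l \<le> j" for j l
    proof -
      have "j \<le> fst (fst (s j))" using strict_mono_imp_increasing[OF sm] .
      then have "V (fst (fst (s j))) \<subseteq> V l" using that unfolding V_def by (auto intro: order_trans)
      then show ?thesis using s(2)[of j] unfolding v_def by blast
    qed
    have "\<exists>\<^sub>F x in filter_integral sequentially F. x \<in> B \<and> f x \<in> Z"
      if "infinite (Z \<inter> range v)" for Z
      unfolding frequently_lim
    proof
      fix l
      \<comment> \<open>Discarding the finitely many values with index below \<open>l\<close> leaves
        one that belongs to \<open>V l\<close>.\<close>
      have "infinite (Z \<inter> range v - v ` {..<l})" using that by simp
      then obtain j where j: "v j \<in> Z" "v j \<notin> v ` {..<l}"
        using infinite_imp_nonempty by blast
      then have "l \<le> j" by (auto simp: not_less)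
      from vV[OF this] obtain n where "n \<ge> l" "\<exists>\<^sub>F x in F n. x \<in> B \<and> f x \<in> {v j}"
        unfolding V_def by blast
      then show "\<exists>n\<ge>l. \<exists>\<^sub>F x in F n. x \<in> B \<and> f x \<in> Z"
        using j(1) by (auto elim!: frequently_elim1)
    qed
    then show ?thesis
      using inj by (intro exI[of _ "{range v}"]) (auto simp: finite_image_iff)
  qed
qed

section \<open>Existence of contours of every rank, and change of rank\<close>

text \<open>Running maxima of an enumeration of the countably many ordinals below
  \<open>\<beta>\<close>.\<close>

lemma ex_least_strict_bound:
  assumes "0 < (\<beta> :: omega1)"
  shows "\<exists>d. least_strict_bound d \<beta>"
proof -
  define c where "c = from_nat_into {..<\<beta>}"
  have ne: "{..<\<beta>} \<noteq> {}" using assms by auto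
  have c: "c n < \<beta>" for n using from_nat_into[OF ne] by (auto simp: c_def)
  have surj: "\<exists>n. c n = x" if "x < \<beta>" for x
    using from_nat_into_surj[OF countable_initial_omega1] that unfolding c_def by blast
  have "least_strict_bound (\<lambda>n. Max (c ` {..n})) \<beta>"
    unfolding least_strict_bound_def
  proof (intro conjI allI impI)
    show "mono (\<lambda>n. Max (c ` {..n}))" by (intro monoI Max_mono) auto
    show "Max (c ` {..n}) < \<beta>" for n using c by (subst Max_less_iff) auto
    fix x assume "x < \<beta>"
    then obtain n where "c n = x" using surj by blast
    then have "x \<le> Max (c ` {..n})" by (intro Max_ge) auto
    then show "\<exists>n. x \<le> Max (c ` {..n})" ..
  qed
  then show ?thesis by blast
qed

text \<open>Allows lower bounds, such as positivity, to be imposed on the ranks of the pieces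
  without changing the rank of the limit.\<close>

lemma least_strict_bound_max:
  assumes "least_strict_bound d \<beta>" "mono a" "\<And>n. a n < \<beta>"
  shows "least_strict_bound (\<lambda>n. max (a n) (d n)) \<beta>"
  using assms unfolding least_strict_bound_def mono_def by (fastforce simp: le_max_iff_disj max.coboundedI1 max.coboundedI2)

lemma least_strict_bound_shift:
  assumes "least_strict_bound a \<alpha>"
  shows "least_strict_bound (\<lambda>n. a (n + m)) \<alpha>"
  unfolding least_strict_bound_def
proof (intro conjI allI impI)
  show "mono (\<lambda>n. a (n + m))" using least_strict_boundD(1)[OF assms] by (simp add: mono_def)
  show "a (n + m) < \<alpha>" for n using least_strict_boundD(2)[OF assms] .
  fix \<beta> assume "\<beta> < \<alpha>"
  then obtain k where "\<And>n. n \<ge> k \<Longrightarrow> \<beta> \<le> a n"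
    using least_strict_bound_eventually[OF assms] by blast
  then show "\<exists>n. \<beta> \<le> a (n + m)" by (intro exI[of _ k]) simp
qed

lemma filter_integral_sequentially_shift:
  "filter_integral sequentially (\<lambda>n. F (n + m)) = filter_integral sequentially F"
  unfolding filter_eq_iff eventually_filter_integral
  by (intro allI) (rule eventually_sequentially_seg)

lemma filter_integral_sequentially_mono:
  assumes "\<And>n. F n \<le> G n"
  shows "filter_integral sequentially F \<le> filter_integral sequentially G"
  using assms unfolding le_filter_def eventually_filter_integral by (auto elim: eventually_mono)

lemma eventually_frechet_on: "eventually P (frechet_on S) \<longleftrightarrow> finite {x \<in> S. \<not> P x}"
proof -
  have "{x. \<not> (x \<in> S \<longrightarrow> P x)} = {x \<in> S. \<not> P x}" by auto
  then show ?thesis by (simp add: frechet_on_def eventually_inf_principal eventually_cofinite)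
qed

text \<open>A point lies in at most one of the disjoint pieces, so its complement belongs to the
  limit; finitely many points are then excluded together.\<close>

lemma contour_on_le_frechet:
  assumes "contour_on \<alpha> D F" "0 < \<alpha>"
  shows "F \<le> frechet_on D"
  unfolding le_filter_def eventually_frechet_on
proof (intro allI impI)
  obtain a E G where G: "\<And>n. contour_on (a n) (E n) (G n)" and E: "disjoint_family E"
    and F: "F = filter_integral sequentially G"
    using contour_on_posE[OF assms] by metis
  have ne: "eventually (\<lambda>y. y \<noteq> x) F" for x
  proof -
    have "\<exists>k. \<forall>n\<ge>k. x \<notin> E n"
    proof (cases "\<exists>m. x \<in> E m")
      case True
      then obtain m where "x \<in> E m" ..
      then have "x \<notin> E n" if "n \<ge> Suc m" for n
        using disjoint_family_onD[OF E, of m n] that by auto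
      then show ?thesis by blast
    qed auto
    then obtain k where k: "\<And>n. n \<ge> k \<Longrightarrow> x \<notin> E n" by blast
    have "eventually (\<lambda>y. y \<noteq> x) (G n)" if "n \<ge> k" for n
      using contour_on_eventually[OF G[of n]] by (rule eventually_mono) (use k[OF that] in auto)
    then show ?thesis
      unfolding F eventually_filter_integral eventually_sequentially by blast
  qed
  fix P assume "finite {x \<in> D. \<not> P x}"
  then have "eventually (\<lambda>y. \<forall>x\<in>{x \<in> D. \<not> P x}. y \<noteq> x) F"
    using ne by (intro eventually_ball_finite) auto
  with contour_on_eventually[OF assms(1)] show "eventually P F"
    by eventually_elim blast
qed

lemma contour_on_infinite:
  assumes "contour_on \<alpha> D F" "0 < \<alpha>"
  shows "infinite D"
proof
  assume "finite D"
  then have "eventually (\<lambda>_. False) (frechet_on D)" by (simp add: eventually_frechet_on)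
  then have "eventually (\<lambda>_. False) F"
    using contour_on_le_frechet[OF assms] by (simp add: le_filter_def)
  then show False using contour_on_neq_bot[OF assms(1)] by (simp add: trivial_limit_def)
qed

text \<open>The hypotheses on \<open>\<beta>\<close> say that it is the ordinal 1.\<close>

lemma contour_on_rank_one:
  assumes "contour_on \<beta> D F" "0 < \<beta>" "\<And>\<delta>. \<delta> < \<beta> \<Longrightarrow> \<delta> = 0"
  shows "F = frechet_on D"
proof -
  obtain a E G where G: "\<And>n. contour_on (a n) (E n) (G n)" and E: "disjoint_family E"
    and a: "least_strict_bound a \<beta>" and D: "D = (\<Union>n. E n)" and F: "F = filter_integral sequentially G"
    using contour_on_posE[OF assms(1,2)] by metis
  have "contour_on 0 (E n) (G n)" for n
    using G[of n] assms(3)[OF least_strict_boundD(2)[OF a]] by simp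
  then have "\<forall>n. \<exists>x. E n = {x} \<and> G n = principal {x}" using contour_on_zeroD by blast
  then obtain x where x: "\<And>n. E n = {x n}" "\<And>n. G n = principal {x n}" by metis
  have inj: "inj x"
  proof (rule injI)
    fix m n assume "x m = x n"
    then show "m = n" using disjoint_family_onD[OF E, of m n] x(1) by (cases "m = n") auto
  qed
  have "{y \<in> D. \<not> P y} = x ` {n. \<not> P (x n)}" for P
    using x(1) by (auto simp: D)
  then have "finite {y \<in> D. \<not> P y} \<longleftrightarrow> finite {n. \<not> P (x n)}" for P
    using inj by (simp add: finite_image_iff inj_on_subset)
  then show ?thesis
    unfolding filter_eq_iff F eventually_filter_integral eventually_frechet_on x(2)
    by (simp add: eventually_principal cofinite_eq_sequentially[symmetric] eventually_cofinite)
qed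

text \<open>Induction on \<open>\<beta>\<close>. For rank 1 the pieces are the points of
  \<open>D\<close>. Above that, \<open>D\<close> is split into infinitely many infinite pieces,
  whose ranks are kept positive because a contour of rank 0 lives on a single point.\<close>

lemma ex_contour_on:
  assumes "infinite D" "0 < \<beta>"
  shows "\<exists>F. contour_on \<beta> D F"
  using assms
proof (induction \<beta> arbitrary: D rule: less_induct)
  case (less \<beta>)
  show ?case
  proof (cases "\<exists>\<delta><\<beta>. \<delta> \<noteq> 0")
    case False
    have "least_strict_bound (\<lambda>_. 0) \<beta>"
      using False less.prems(2) by (auto simp: least_strict_bound_def mono_def)
    from contour_on.lim[OF contour_on.point _ this, of "enumerate D"]
    have "disjoint_family (\<lambda>n. {enumerate D n}) \<Longrightarrow>
        contour_on \<beta> (\<Union>n. {enumerate D n}) (filter_integral sequentially (\<lambda>n. principal {enumerate D n}))" .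
    moreover have "disjoint_family (\<lambda>n. {enumerate D n})"
      using inj_enumerate[OF less.prems(1)] by (auto simp: disjoint_family_on_def inj_def)
    moreover have "(\<Union>n. {enumerate D n}) = D" using range_enumerate[OF less.prems(1)] by auto
    ultimately show ?thesis by auto
  next
    case True
    then obtain \<delta> where \<delta>: "\<delta> < \<beta>" "0 < \<delta>" using zero_less_omega1 by blast
    obtain d where d: "least_strict_bound d \<beta>" using ex_least_strict_bound[OF less.prems(2)] by blast
    have b: "least_strict_bound (\<lambda>n. max \<delta> (d n)) \<beta>"
      using least_strict_bound_max[OF d, of "\<lambda>_. \<delta>"] \<delta> by (simp add: mono_def)
    define E where "E n = enumerate D ` (\<lambda>m. prod_encode (n, m)) ` UNIV" for n
    have enum_inj: "inj (enumerate D)" using inj_enumerate[OF less.prems(1)] .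
    have "infinite (E n)" for n
      unfolding E_def image_image
      by (rule range_inj_infinite) (auto intro!: injI dest!: injD[OF enum_inj])
    moreover have "0 < max \<delta> (d n)" for n using \<delta> by (simp add: less_max_iff_disj)
    moreover note least_strict_boundD(2)[OF b]
    ultimately have "\<exists>F. contour_on (max \<delta> (d n)) (E n) F" for n
      using less.IH by blast
    then obtain F where F: "\<And>n. contour_on (max \<delta> (d n)) (E n) (F n)" by metis
    have "disjoint_family E"
      unfolding disjoint_family_on_def E_def by (auto dest!: injD[OF enum_inj])
    from contour_on.lim[OF F this b]
    have "contour_on \<beta> (\<Union>n. E n) (filter_integral sequentially F)" .
    moreover have "(\<Union>n. E n) = D"
    proof -
      have "(\<Union>n. range (\<lambda>m. prod_encode (n, m))) = UNIV"
        by (auto simp: set_eq_iff image_iff) (metis prod_decode_inverse surj_pair)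
      then have "(\<Union>n. E n) = enumerate D ` UNIV" unfolding E_def image_UN[symmetric] by simp
      then show ?thesis using range_enumerate[OF less.prems(1)] by simp
    qed
    ultimately show ?thesis by auto
  qed
qed

text \<open>A contour of rank 1 is the Frechet filter of an infinite set and is contained in every
  contour of positive rank on that set. For larger \<open>\<alpha>\<close> the pieces are refined to
  ranks \<open>max (a (n + m)) (d n)\<close>, where \<open>d\<close> has least strict bound
  \<open>\<beta>\<close>.\<close>

lemma contour_on_refine:
  assumes "contour_on \<alpha> D F" "0 < \<alpha>" "\<alpha> \<le> \<beta>"
  shows "\<exists>D' F'. contour_on \<beta> D' F' \<and> D' \<subseteq> D \<and> F' \<le> F"
  using assms
proof (induction arbitrary: \<beta> rule: contour_on.induct)
  case (lim a D F \<alpha>)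
  have con: "contour_on \<alpha> (\<Union>n. D n) (filter_integral sequentially F)"
    using contour_on.lim lim.hyps by blast
  have \<beta>: "0 < \<beta>" using lim.prems by simp
  show ?case
  proof (cases "\<exists>\<delta><\<alpha>. \<delta> \<noteq> 0")
    case False
    then have "filter_integral sequentially F = frechet_on (\<Union>n. D n)"
      using contour_on_rank_one[OF con lim.prems(1)] by blast
    then show ?thesis
      using ex_contour_on[OF contour_on_infinite[OF con lim.prems(1)] \<beta>] contour_on_le_frechet[OF _ \<beta>]
      by (metis order_refl)
  next
    case True
    then obtain \<delta> where "\<delta> < \<alpha>" "0 < \<delta>" using zero_less_omega1 by blast
    \<comment> \<open>The induction hypothesis applies to positive ranks only; omitting the first
      \<open>m\<close> pieces leaves the limit filter unchanged.\<close>
    then obtain m where m: "\<And>n. n \<ge> m \<Longrightarrow> 0 < a n"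
      using least_strict_bound_eventually[OF lim.hyps(3)] less_le_trans by meson
    obtain d where d: "least_strict_bound d \<beta>" using ex_least_strict_bound[OF \<beta>] by blast
    have a: "least_strict_bound (\<lambda>n. a (n + m)) \<alpha>"
      using least_strict_bound_shift lim.hyps(3) .
    have b: "least_strict_bound (\<lambda>n. max (a (n + m)) (d n)) \<beta>"
      using least_strict_bound_max[OF d least_strict_boundD(1)[OF a]]
        least_strict_boundD(2)[OF a] lim.prems(2) less_le_trans by blast
    have "\<exists>D' F'. contour_on (max (a (n + m)) (d n)) D' F' \<and> D' \<subseteq> D (n + m) \<and> F' \<le> F (n + m)" for n
      using lim.IH[of "n + m" "max (a (n + m)) (d n)"] m[of "n + m"] by simp
    then obtain D' F' where F': "\<And>n. contour_on (max (a (n + m)) (d n)) (D' n) (F' n)"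
      and D': "\<And>n. D' n \<subseteq> D (n + m)" and le: "\<And>n. F' n \<le> F (n + m)" by metis
    have "disjoint_family D'"
      unfolding disjoint_family_on_def
    proof (intro ballI impI)
      fix i j :: nat assume "i \<noteq> j"
      then show "D' i \<inter> D' j = {}"
        using D'[of i] D'[of j] disjoint_family_onD[OF lim.hyps(2), of "i + m" "j + m"] by auto
    qed
    from contour_on.lim[OF F' this b]
    have "contour_on \<beta> (\<Union>n. D' n) (filter_integral sequentially F')" .
    moreover have "filter_integral sequentially F' \<le> filter_integral sequentially F"
      using filter_integral_sequentially_mono[of F' "\<lambda>n. F (n + m)"] le
      by (simp add: filter_integral_sequentially_shift)
    moreover have "(\<Union>n. D' n) \<subseteq> (\<Union>n. D n)" using D' by blast
    ultimately show ?thesis by blast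
  qed
qed simp

text \<open>For rank 1 the Frechet filter of \<open>D\<close> is taken. If
  \<open>1 < \<beta> < \<alpha>\<close>, almost all pieces have rank at least
  \<open>\<beta>\<close>, and the induction hypothesis lowers them to positive ranks with least
  strict bound \<open>\<beta>\<close>.\<close>

lemma contour_on_coarsen:
  assumes "contour_on \<alpha> D F" "0 < \<beta>" "\<beta> \<le> \<alpha>"
  shows "\<exists>D' F'. contour_on \<beta> D' F' \<and> D' \<subseteq> D \<and> F \<le> F'"
  using assms
proof (induction arbitrary: \<beta> rule: contour_on.induct)
  case (point x)
  then show ?case by simp
next
  case (lim a D F \<alpha>)
  have con: "contour_on \<alpha> (\<Union>n. D n) (filter_integral sequentially F)"
    using contour_on.lim lim.hyps by blast
  have \<alpha>: "0 < \<alpha>" using lim.prems by simp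
  consider "\<beta> = \<alpha>" | "\<forall>\<delta><\<beta>. \<delta> = 0" | \<delta> where "\<beta> < \<alpha>" "\<delta> < \<beta>" "\<delta> \<noteq> 0"
    using lim.prems(2) by force
  then show ?case
  proof cases
    case 1
    then show ?thesis using con by blast
  next
    case 2
    obtain F' where F': "contour_on \<beta> (\<Union>n. D n) F'"
      using ex_contour_on[OF contour_on_infinite[OF con \<alpha>] lim.prems(1)] by blast
    moreover have "F' = frechet_on (\<Union>n. D n)"
      using contour_on_rank_one[OF F' lim.prems(1)] 2 by blast
    ultimately show ?thesis using contour_on_le_frechet[OF con \<alpha>] by blast
  next
    case 3
    then obtain m where m: "\<And>n. n \<ge> m \<Longrightarrow> \<beta> \<le> a n"
      using least_strict_bound_eventually[OF lim.hyps(3)] by blast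
    obtain d where d: "least_strict_bound d \<beta>" using ex_least_strict_bound[OF lim.prems(1)] by blast
    have b: "least_strict_bound (\<lambda>n. max \<delta> (d n)) \<beta>"
      using least_strict_bound_max[OF d, of "\<lambda>_. \<delta>"] 3 by (simp add: mono_def)
    have "max \<delta> (d n) \<le> a (n + m)" for n
      by (rule less_imp_le[OF less_le_trans[OF least_strict_boundD(2)[OF b] m]]) simp
    moreover have "0 < max \<delta> (d n)" for n
      using zero_less_omega1[OF 3(3)] by (simp add: less_max_iff_disj)
    ultimately have "\<exists>D' F'. contour_on (max \<delta> (d n)) D' F' \<and> D' \<subseteq> D (n + m) \<and> F (n + m) \<le> F'" for n
      using lim.IH[of "max \<delta> (d n)" "n + m"] by blast
    then obtain D' F' where F': "\<And>n. contour_on (max \<delta> (d n)) (D' n) (F' n)"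
      and D': "\<And>n. D' n \<subseteq> D (n + m)" and le: "\<And>n. F (n + m) \<le> F' n" by metis
    have "disjoint_family D'"
      unfolding disjoint_family_on_def
    proof (intro ballI impI)
      fix i j :: nat assume "i \<noteq> j"
      then show "D' i \<inter> D' j = {}"
        using D'[of i] D'[of j] disjoint_family_onD[OF lim.hyps(2), of "i + m" "j + m"] by auto
    qed
    from contour_on.lim[OF F' this b]
    have "contour_on \<beta> (\<Union>n. D' n) (filter_integral sequentially F')" .
    moreover have "filter_integral sequentially F \<le> filter_integral sequentially F'"
      using filter_integral_sequentially_mono[of "\<lambda>n. F (n + m)" F'] le
      by (simp add: filter_integral_sequentially_shift)
    moreover have "(\<Union>n. D' n) \<subseteq> (\<Union>n. D n)" using D' by blast
    ultimately show ?thesis by blast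
  qed
qed

text \<open>
  The sets of a contour are parametrized by the functions that tell, for each inner node of the
  cascade, how many of its immediate successors are discarded.
\<close>

lemma contour_on_monotone_base:
  assumes "contour_on \<alpha> D F"
  shows "\<exists>\<Phi> :: (nat \<Rightarrow> nat) \<Rightarrow> nat set. (\<forall>g. eventually (\<lambda>x. x \<in> \<Phi> g) F) \<and>
    (\<forall>g h. g \<le> h \<longrightarrow> \<Phi> h \<subseteq> \<Phi> g) \<and> (\<forall>A. eventually (\<lambda>x. x \<in> A) F \<longrightarrow> (\<exists>g. \<Phi> g \<subseteq> A))"
  using assms
proof induction
  case (point x)
  show ?case by (rule exI[of _ "\<lambda>_. {x}"]) (auto simp: eventually_principal)
next
  case (lim a D F \<alpha>)
  define base where "base n \<Phi> \<longleftrightarrow> (\<forall>g. eventually (\<lambda>x. x \<in> \<Phi> g) (F n)) \<and>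
    (\<forall>g h. g \<le> h \<longrightarrow> \<Phi> h \<subseteq> \<Phi> g) \<and> (\<forall>A. eventually (\<lambda>x. x \<in> A) (F n) \<longrightarrow> (\<exists>g. \<Phi> g \<subseteq> A))"
    for n and \<Phi> :: "(nat \<Rightarrow> nat) \<Rightarrow> nat set"
  obtain \<Phi> where "\<And>n. base n (\<Phi> n)" using lim.IH unfolding base_def by metis
  then have \<Phi>: "\<And>n g. eventually (\<lambda>x. x \<in> \<Phi> n g) (F n)" "\<And>n g h. g \<le> h \<Longrightarrow> \<Phi> n h \<subseteq> \<Phi> n g"
    "\<And>n A. eventually (\<lambda>x. x \<in> A) (F n) \<Longrightarrow> \<exists>g. \<Phi> n g \<subseteq> A"
    unfolding base_def by auto
  \<comment> \<open>The value \<open>g 0\<close> says how many pieces are discarded; the other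
    values are distributed over the pieces, coordinate \<open>i\<close> for piece \<open>n\<close>
    standing at \<open>Suc (prod_encode (n, i))\<close>.\<close>
  define \<Psi> where "\<Psi> g = (\<Union>n\<in>{g 0..}. \<Phi> n (\<lambda>i. g (Suc (prod_encode (n, i)))))" for g :: "nat \<Rightarrow> nat"
  have "eventually (\<lambda>x. x \<in> \<Psi> g) (filter_integral sequentially F)" for g
    unfolding eventually_filter_integral eventually_sequentially
  proof (intro exI[of _ "g 0"] allI impI)
    fix n assume "g 0 \<le> n"
    then have "\<Phi> n (\<lambda>i. g (Suc (prod_encode (n, i)))) \<subseteq> \<Psi> g" unfolding \<Psi>_def by auto
    then show "eventually (\<lambda>x. x \<in> \<Psi> g) (F n)"
      using \<Phi>(1)[of n "\<lambda>i. g (Suc (prod_encode (n, i)))"] by (auto elim: eventually_mono)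
  qed
  moreover have "\<Psi> h \<subseteq> \<Psi> g" if "g \<le> h" for g h
  proof -
    have "g 0 \<le> h 0" using that by (simp add: le_fun_def)
    moreover have "\<Phi> n (\<lambda>i. h (Suc (prod_encode (n, i)))) \<subseteq> \<Phi> n (\<lambda>i. g (Suc (prod_encode (n, i))))" for n
      using that by (intro \<Phi>(2)) (simp add: le_fun_def)
    ultimately show ?thesis unfolding \<Psi>_def by (intro UN_mono) auto
  qed
  moreover have "\<exists>g. \<Psi> g \<subseteq> A" if A: "eventually (\<lambda>x. x \<in> A) (filter_integral sequentially F)" for A
  proof -
    obtain m where m: "\<forall>n\<ge>m. eventually (\<lambda>x. x \<in> A) (F n)"
      using A unfolding eventually_filter_integral eventually_sequentially by blast
    define g where "g n = (SOME g. \<Phi> n g \<subseteq> A)" for n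
    have g: "\<Phi> n (g n) \<subseteq> A" if "n \<ge> m" for n
      unfolding g_def by (rule someI_ex[OF \<Phi>(3)[OF m[rule_format, OF that]]])
    define h where "h i = (case i of 0 \<Rightarrow> m | Suc j \<Rightarrow> case prod_decode j of (n, i) \<Rightarrow> g n i)" for i
    have "\<Psi> h \<subseteq> A" using g unfolding \<Psi>_def h_def by auto
    then show ?thesis by blast
  qed
  ultimately show ?case by (intro exI[of _ \<Psi>]) blast
qed

section \<open>Martin's Axiom\<close>

abbreviation small :: "'a set \<Rightarrow> bool" where
  "small A \<equiv> A \<prec> (UNIV :: nat set set)"

lemma small_mono: "A \<subseteq> B \<Longrightarrow> small B \<Longrightarrow> small A"
  using lesspoll_trans1 subset_imp_lepoll by blast

lemma small_image: "small A \<Longrightarrow> small (f ` A)"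
  using lesspoll_trans1 image_lepoll by blast

lemma small_countable:
  assumes "countable A"
  shows "small A"
proof -
  have "A \<lesssim> (UNIV :: nat set)" using assms unfolding countable_def lepoll_def by blast
  moreover have "(UNIV :: nat set) \<prec> (UNIV :: nat set set)"
    using lesspoll_Pow_self[of "UNIV :: nat set"] by simp
  ultimately show ?thesis by (rule lesspoll_trans1)
qed

lemma lepoll_iff_card_of_ordLeq: "A \<lesssim> B \<longleftrightarrow> ordLeq3 (card_of A) (card_of B)"
  unfolding lepoll_def card_of_ordLeq ..

lemma infinite_Times_lepoll:
  assumes "A \<lesssim> B" "infinite B"
  shows "A \<times> B \<lesssim> B"
proof -
  have "A \<times> B \<lesssim> B \<times> B" using assms(1) by (intro times_lepoll_mono) auto
  also have "B \<times> B \<lesssim> B"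
    using card_of_Times_same_infinite[OF assms(2)] eqpoll_iff_card_of_ordIso eqpoll_imp_lepoll by blast
  finally show ?thesis .
qed

text \<open>If the two sets are not both finite, the larger one is infinite and absorbs the
  product.\<close>

lemma small_Times:
  assumes "small A" "small B"
  shows "small (A \<times> B)"
proof (cases "finite A \<and> finite B")
  case True
  then show ?thesis by (intro small_countable countable_finite) simp
next
  case False
  consider "A \<lesssim> B" "infinite B" | "B \<lesssim> A" "infinite A"
    using False ordLeq_total[OF card_of_Well_order card_of_Well_order, of A B]
    unfolding lepoll_iff_card_of_ordLeq[symmetric] by (meson countable_finite finite_lepoll_infinite lepoll_trans infinite_le_lepoll)
  then show ?thesis
  proof cases
    case 1
    then show ?thesis by (intro lesspoll_trans1[OF infinite_Times_lepoll assms(2)])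
  next
    case 2
    then have "A \<times> B \<lesssim> A"
      by (intro lepoll_trans1[OF times_commute_eqpoll infinite_Times_lepoll])
    then show ?thesis using assms(1) by (rule lesspoll_trans1)
  qed
qed

lemma small_UN_countable:
  assumes "small I" "\<And>i. i \<in> I \<Longrightarrow> countable (X i)"
  shows "small (\<Union>i\<in>I. X i)"
proof -
  have "(\<Union>i\<in>I. X i) \<subseteq> (\<lambda>(i, n). from_nat_into (X i) n) ` (I \<times> (UNIV :: nat set))"
    using from_nat_into_surj[OF assms(2)] by (force simp: image_iff)
  moreover have "small (I \<times> (UNIV :: nat set))"
    using assms(1) small_countable[of "UNIV :: nat set"] by (intro small_Times) auto
  ultimately show ?thesis using small_image small_mono by blast
qed

lemma small_Un:
  fixes A B :: "'a set"
  assumes "small A" "small B"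
  shows "small (A \<union> B)"
proof (cases "A = {} \<or> B = {}")
  case False
  then have "A \<union> B \<subseteq> (\<lambda>((a, b), c). if c then a else b) ` ((A \<times> B) \<times> (UNIV :: bool set))"
    by (auto simp: image_iff) blast+
  moreover have "small ((A \<times> B) \<times> (UNIV :: bool set))"
    using assms by (intro small_Times small_countable[of "UNIV :: bool set"]) auto
  ultimately show ?thesis using small_image small_mono by blast
qed (use assms in auto)

text \<open>Bounds the number of requirements at one stage of the construction. For infinite
  \<open>\<B>\<close> the finite intersections arise in countably many rounds, and no round produces
  more sets than \<open>\<B>\<close> has members.\<close>

lemma small_finite_Inter:
  assumes "small \<B>"
  shows "small {\<Inter>\<C> | \<C>. finite \<C> \<and> \<C> \<subseteq> \<B>}"
proof (cases "finite \<B>")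
  case True
  have "{\<Inter>\<C> | \<C>. finite \<C> \<and> \<C> \<subseteq> \<B>} \<subseteq> Inter ` Pow \<B>" by auto
  moreover have "small (Inter ` Pow \<B>)" using True by (intro small_countable countable_finite) simp
  ultimately show ?thesis by (rule small_mono)
next
  case False
  \<comment> \<open>For every \<open>n\<close>, \<open>X (Suc n)\<close> consists of the
    intersections of at most \<open>n\<close> members of \<open>\<B>\<close>.\<close>
  define X where "X n = ((\<lambda>Y. insert UNIV ((\<lambda>(B, C). B \<inter> C) ` (\<B> \<times> Y))) ^^ n) {}" for n
  have "X n \<lesssim> \<B>" for n
  proof (induction n)
    case 0
    then show ?case by (simp add: X_def)
  next
    case (Suc n)
    have "\<B> \<times> X n \<lesssim> \<B> \<times> \<B>" using Suc by (intro times_lepoll_mono) auto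
    also have "\<B> \<times> \<B> \<lesssim> \<B>" using infinite_Times_lepoll[OF lepoll_refl False] .
    finally have le: "(\<lambda>(B, C). B \<inter> C) ` (\<B> \<times> X n) \<lesssim> \<B>" using image_lepoll lepoll_trans by blast
    have "X (Suc n) = insert UNIV ((\<lambda>(B, C). B \<inter> C) ` (\<B> \<times> X n))" by (simp add: X_def)
    moreover have "insert UNIV ((\<lambda>(B, C). B \<inter> C) ` (\<B> \<times> X n)) \<lesssim> \<B>"
    proof (cases "finite ((\<lambda>(B, C). B \<inter> C) ` (\<B> \<times> X n))")
      case True
      then show ?thesis by (intro finite_lepoll_infinite[OF False]) simp
    next
      case inf: False
      then show ?thesis using lepoll_trans[OF infinite_insert_lepoll[OF inf] le] by blast
    qed
    ultimately show ?case by simp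
  qed
  then have "(\<Union>n. X n) \<lesssim> \<B>"
    unfolding lepoll_iff_card_of_ordLeq
    by (intro card_of_UNION_ordLeq_infinite[OF False])
      (use False infinite_iff_card_of_nat in auto)
  moreover have "{\<Inter>\<C> | \<C>. finite \<C> \<and> \<C> \<subseteq> \<B>} \<lesssim> (\<Union>n. X n)"
  proof (rule subset_imp_lepoll, clarify)
    fix \<C> assume "finite \<C>" "\<C> \<subseteq> \<B>"
    then show "\<Inter>\<C> \<in> (\<Union>n. X n)"
    proof (induction \<C>)
      case empty
      have "UNIV \<in> X 1" by (simp add: X_def)
      then show ?case by auto
    next
      case (insert B \<C>)
      then obtain n where "\<Inter>\<C> \<in> X n" by auto
      then have "B \<inter> \<Inter>\<C> \<in> X (Suc n)" using insert.prems by (force simp: X_def)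
      then show ?case by auto
    qed
  qed
  ultimately have "{\<Inter>\<C> | \<C>. finite \<C> \<and> \<C> \<subseteq> \<B>} \<lesssim> \<B>" by (rule lepoll_trans[rotated])
  then show ?thesis using assms by (rule lesspoll_trans1)
qed

section \<open>Generic objects for orders with countably many linked classes\<close>

text \<open>Conditions with the same value of \<open>h\<close> are compatible, so \<open>h\<close>
  is injective on every antichain, and its countable range gives the countable chain condition. In
  \<open>le s p\<close> the stronger condition is \<open>s\<close>.\<close>

lemma martins_axiom_sigma_linked:
  fixes P :: "'a set" and le :: "'a \<Rightarrow> 'a \<Rightarrow> bool" and h :: "'a \<Rightarrow> 'b :: countable"
  assumes "martins_axiom" and ne: "P \<noteq> {}"
    and refl: "\<forall>p\<in>P. le p p"
    and trans: "\<forall>p\<in>P. \<forall>q\<in>P. \<forall>r\<in>P. le p q \<longrightarrow> le q r \<longrightarrow> le p r"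
    and antisym: "\<forall>p q. le p q \<longrightarrow> le q p \<longrightarrow> p = q"
    and linked: "\<forall>p\<in>P. \<forall>q\<in>P. h p = h q \<longrightarrow> (\<exists>s\<in>P. le s p \<and> le s q)"
    and small: "small \<D>"
    and dense: "\<forall>D\<in>\<D>. \<forall>p\<in>P. \<exists>d\<in>D \<inter> P. le d p"
  shows "\<exists>G \<subseteq> P. (\<forall>p\<in>G. \<forall>q\<in>G. \<exists>s\<in>G. le s p \<and> le s q) \<and> (\<forall>D\<in>\<D>. G \<inter> D \<noteq> {})"
proof -
  define r where "r = {(s, p). s \<in> P \<and> p \<in> P \<and> le s p}"
  have F: "Field r = P" using refl unfolding r_def Field_def by auto
  have "Partial_order r"
    unfolding order_on_defs F
  proof (intro conjI)
    show "r \<subseteq> P \<times> P" by (auto simp: r_def)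
    show "refl_on P r" using refl by (auto simp: refl_on_def r_def)
    show "Relation.trans r" unfolding trans_def r_def using trans by blast
    show "Relation.antisym r" unfolding antisym_def r_def using antisym by blast
  qed
  moreover have "ccc r"
    unfolding ccc_def F
  proof (intro allI impI)
    fix A assume A: "A \<subseteq> P" "\<forall>p\<in>A. \<forall>q\<in>A. p \<noteq> q \<longrightarrow> \<not> compatible r p q"
    have "inj_on h A"
    proof (rule inj_onI, rule ccontr)
      fix p q assume pq: "p \<in> A" "q \<in> A" "h p = h q" "p \<noteq> q"
      then have "compatible r p q"
        using linked A(1) unfolding compatible_def r_def by blast
      then show False using A(2) pq by blast
    qed
    then show "countable A" by (rule countable_image_inj_on[rotated]) simp
  qed
  moreover have "small ((\<lambda>D. D \<inter> P) ` \<D>)" using small small_image by blast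
  moreover have "\<forall>D\<in>(\<lambda>D. D \<inter> P) ` \<D>. dense_in r D"
    using dense unfolding dense_in_def F by (fastforce simp: r_def)
  ultimately obtain G where G: "order_filter r G" "\<forall>D\<in>(\<lambda>D. D \<inter> P) ` \<D>. G \<inter> D \<noteq> {}"
    using martins_axiom_all[OF assms(1), of r] ne unfolding martins_axiom_for_def F by blast
  show ?thesis
  proof (intro exI[of _ G] conjI ballI)
    show "G \<subseteq> P" using G(1) F unfolding order_filter_def by blast
    show "\<exists>s\<in>G. le s p \<and> le s q" if pq: "p \<in> G" "q \<in> G" for p q
      using G(1) pq unfolding order_filter_def r_def by fast
    show "G \<inter> D \<noteq> {}" if D: "D \<in> \<D>" for D using bspec[OF G(2) imageI[OF D]] by blast
  qed
qed

text \<open>Hechler forcing: a condition is a finite initial segment of the future \<open>g\<close>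
  with a finite set of functions that all later values must dominate. Conditions with equal segments
  are compatible, since their promises can be united.\<close>

lemma martins_axiom_dominating:
  fixes \<G> :: "(nat \<Rightarrow> nat) set"
  assumes "martins_axiom" "small \<G>"
  shows "\<exists>g. \<forall>f\<in>\<G>. \<exists>m. \<forall>n\<ge>m. f n \<le> g n"
proof -
  define P where "P = {p :: nat list \<times> (nat \<Rightarrow> nat) set. finite (snd p) \<and> snd p \<subseteq> \<G>}"
  define le where "le p q \<longleftrightarrow> prefix (fst q) (fst p) \<and> snd q \<subseteq> snd p \<and>
    (\<forall>f\<in>snd q. \<forall>i. length (fst q) \<le> i \<and> i < length (fst p) \<longrightarrow> f i \<le> fst p ! i)"
    for p q :: "nat list \<times> (nat \<Rightarrow> nat) set"
  have pre: "l ! i = l' ! i" if "prefix l l'" "i < length l" for l l' :: "nat list" and i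
    using that by (auto simp: prefix_def nth_append)
  define \<D> where "\<D> = (\<lambda>f. {p. f \<in> snd p}) ` \<G> \<union> range (\<lambda>n. {p :: nat list \<times> (nat \<Rightarrow> nat) set. n < length (fst p)})"
  have small: "small \<D>"
    unfolding \<D>_def by (intro small_Un small_image assms(2) small_countable) simp
  have dense: "\<exists>d\<in>D \<inter> P. le d p" if Dp: "D \<in> \<D>" "p \<in> P" for D p
  proof -
    obtain l S where p: "p = (l, S)" by force
    consider f where "f \<in> \<G>" "D = {p. f \<in> snd p}" | n where "D = {p. n < length (fst p)}"
      using Dp(1) unfolding \<D>_def by blast
    then show ?thesis
    proof cases
      case 1
      then show ?thesis
        using Dp(2) by (intro bexI[of _ "(l, insert f S)"]) (auto simp: p P_def le_def)
    next
      case 2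
      then show ?thesis
        \<comment> \<open>The sum over the finite set \<open>S\<close> bounds every member of
          \<open>S\<close>, so the new entries keep all promises.\<close>
        using Dp(2) by (intro bexI[of _ "(l @ map (\<lambda>i. \<Sum>f\<in>S. f i) [length l..<length l + Suc n], S)"])
          (auto simp: p P_def le_def nth_append simp del: upt_Suc intro!: member_le_sum[where f = "\<lambda>f. f _"])
    qed
  qed
  have trans: "le p r" if "le p q" "le q r" for p q r
  proof -
    have "f i \<le> fst p ! i" if f: "f \<in> snd r" and i: "length (fst r) \<le> i" "i < length (fst p)" for f i
    proof (cases "i < length (fst q)")
      case True
      then have "f i \<le> fst q ! i" using \<open>le q r\<close> f i unfolding le_def by blast
      then show ?thesis using pre[OF _ True] \<open>le p q\<close> unfolding le_def by metis
    next
      case False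
      then show ?thesis using \<open>le p q\<close> \<open>le q r\<close> f i unfolding le_def by (meson in_mono not_less)
    qed
    then show ?thesis using that unfolding le_def by (meson prefix_order.trans subset_trans)
  qed
  have linked: "\<exists>s\<in>P. le s p \<and> le s q" if "p \<in> P" "q \<in> P" "fst p = fst q" for p q
    using that by (intro bexI[of _ "(fst p, snd p \<union> snd q)"]) (auto simp: P_def le_def)
  have ne: "P \<noteq> {}" by (auto simp: P_def intro!: exI[of _ "{}"])
  have refl: "le p p" for p by (auto simp: le_def)
  have antisym: "p = q" if "le p q" "le q p" for p q
    using that prefix_order.antisym unfolding le_def by (metis prod_eqI subset_antisym)
  have "\<exists>G \<subseteq> P. (\<forall>p\<in>G. \<forall>q\<in>G. \<exists>s\<in>G. le s p \<and> le s q) \<and> (\<forall>D\<in>\<D>. G \<inter> D \<noteq> {})"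
    by (rule martins_axiom_sigma_linked[OF assms(1) ne, where h = fst])
      (use refl trans antisym linked small dense in blast)+
  then obtain G where G: "G \<subseteq> P" "\<forall>p\<in>G. \<forall>q\<in>G. \<exists>s\<in>G. le s p \<and> le s q"
    "\<forall>D\<in>\<D>. G \<inter> D \<noteq> {}" by (elim exE conjE)
  have "\<exists>p. p \<in> G \<and> n < length (fst p)" for n
    using bspec[OF G(3), of "{p. n < length (fst p)}"] by (auto simp: \<D>_def)
  then obtain p where p: "\<And>n. p n \<in> G" "\<And>n. n < length (fst (p n))" by metis
  \<comment> \<open>A common extension of \<open>p n\<close> and of a condition that promises
    \<open>f\<close> compares \<open>f n\<close> with the entry at \<open>n\<close>, for every
    \<open>n\<close> beyond the segment of the latter condition.\<close>
  have "\<exists>m. \<forall>n\<ge>m. f n \<le> fst (p n) ! n" if f: "f \<in> \<G>" for f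
  proof -
    obtain q where q: "q \<in> G" "f \<in> snd q" 
      using bspec[OF G(3), of "{p. f \<in> snd p}"] f by (auto simp: \<D>_def)
    have "f n \<le> fst (p n) ! n" if n: "n \<ge> length (fst q)" for n
    proof -
      obtain s where s: "le s q" "le s (p n)" using G(2)[rule_format, OF q(1) p(1)[of n]] by blast
      have "n < length (fst s)"
        using s(2) p(2)[of n] prefix_length_le unfolding le_def by (meson less_le_trans)
      then have "f n \<le> fst s ! n" using s(1) q(2) n unfolding le_def by blast
      then show ?thesis using pre[OF _ p(2)] s(2) unfolding le_def by metis
    qed
    then show ?thesis by blast
  qed
  then show ?thesis by (intro exI[of _ "\<lambda>n. fst (p n) ! n"]) blast
qed


section \<open>Thin sets\<close>

lemma enumerate_range:
  fixes z :: "nat \<Rightarrow> nat"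
  assumes "strict_mono z"
  shows "enumerate (range z) n = z n"
proof (induction n)
  case 0
  show ?case unfolding enumerate_0
    using assms by (intro Least_equality) (auto simp: strict_mono_less_eq)
next
  case (Suc n)
  have "infinite (range z)" using assms strict_mono_imp_inj_on range_inj_infinite by blast
  then have "enumerate (range z) (Suc n) = (LEAST s. s \<in> range z \<and> z n < s)"
    using Suc by (simp add: enumerate_Suc'')
  also have "\<dots> = z (Suc n)"
    using assms by (intro Least_equality) (auto simp: strict_mono_less strict_mono_less_eq)
  finally show ?case .
qed

text \<open>The growth condition bounds the \<open>n\<close>-th ratio by
  \<open>1 / (n + 1)\<close>.\<close>

lemma thin_range:
  assumes z: "\<And>n. Suc n * z n < z (Suc n)"
  shows "thin (range z)" "strict_mono z"
proof -
  have "z n < z (Suc n)" for n using z[of n] by (simp add: add_lessD1)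
  then show sm: "strict_mono z" by (simp add: strict_mono_Suc_iff)
  have "real (z n) / real (z (Suc n)) \<le> inverse (real (Suc n))" for n
  proof -
    have "real (Suc n) * real (z n) \<le> real (z (Suc n))"
      using z[of n] by (simp only: of_nat_mult[symmetric] of_nat_le_iff)
    moreover have "0 < real (z (Suc n))" using z[of n] by simp
    ultimately show ?thesis by (simp add: field_simps)
  qed
  then have "(\<lambda>n. real (z n) / real (z (Suc n))) \<longlonglongrightarrow> 0"
    by (intro tendsto_sandwich[OF _ _ tendsto_const LIMSEQ_inverse_real_of_nat]) auto
  moreover have "infinite (range z)" using sm strict_mono_imp_inj_on range_inj_infinite by blast
  ultimately show "thin (range z)" by (simp add: thin_def enumerate_range[OF sm])
qed

lemma thin_mem_thin_ideal: "thin A \<Longrightarrow> A \<in> thin_ideal"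
  by (auto simp: thin_ideal_def hull_def)

lemma set_ideal_thin_ideal: "set_ideal thin_ideal"
  unfolding set_ideal_def thin_ideal_def hull_def by blast

lemma thin_ideal_subset: "A \<in> thin_ideal \<Longrightarrow> B \<subseteq> A \<Longrightarrow> B \<in> thin_ideal"
  using set_ideal_thin_ideal unfolding set_ideal_def by blast

text \<open>Thin sets are infinite, so a finite set is reached through its points, each of which is
  the first element of some thin set.\<close>

lemma finite_mem_thin_ideal:
  assumes "finite M"
  shows "M \<in> thin_ideal"
  using assms
proof (induction M)
  case empty
  then show ?case using set_ideal_thin_ideal by (simp add: set_ideal_def)
next
  case (insert m M)
  define z where "z = rec_nat m (\<lambda>n x. Suc (Suc n * x))"
  have "Suc n * z n < z (Suc n)" for n by (simp add: z_def)
  then have "range z \<in> thin_ideal" using thin_mem_thin_ideal thin_range by blast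
  moreover have "m \<in> range z" by (rule range_eqI[of _ _ 0]) (simp add: z_def)
  ultimately have "{m} \<in> thin_ideal" using set_ideal_thin_ideal by (simp add: set_ideal_def)
  then have "{m} \<union> M \<in> thin_ideal" using insert.IH set_ideal_thin_ideal unfolding set_ideal_def by blast
  then show ?case by simp
qed

text \<open>The conditions are finite lists with the growth required in \<open>thin_range\<close>,
  ordered by extension. An infinite \<open>E\<close> has members large enough to continue any list,
  so the generic sequence enters \<open>E\<close> at arbitrarily large indices.\<close>

lemma martins_axiom_thin:
  fixes \<E> :: "nat set set"
  assumes "martins_axiom" "small \<E>" "\<And>E. E \<in> \<E> \<Longrightarrow> infinite E"
  shows "\<exists>Z. thin Z \<and> (\<forall>E\<in>\<E>. infinite (Z \<inter> E))"
proof -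
  define P where "P = {l :: nat list. \<forall>i. Suc i < length l \<longrightarrow> Suc i * l ! i < l ! Suc i}"
  \<comment> \<open>\<open>UNIV\<close> is added so that the generic filter contains arbitrarily
    long lists even if \<open>\<E>\<close> is empty.\<close>
  define \<D> where "\<D> = (\<lambda>(E, n). {l :: nat list. \<exists>i\<ge>n. i < length l \<and> l ! i \<in> E}) ` (insert UNIV \<E> \<times> UNIV)"
  have ext: "\<exists>x\<in>E. l @ [x] \<in> P" if l: "l \<in> P" and "infinite E" for l and E :: "nat set"
  proof -
    \<comment> \<open>This is the growth condition for \<open>x\<close> as the next entry; for the
      empty list the product is 0, whatever \<open>last\<close> is.\<close>
    obtain x where x: "x \<in> E" "length l * last l < x"
      using \<open>infinite E\<close> infinite_nat_iff_unbounded by blast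
    have "l @ [x] \<in> P"
      unfolding P_def
    proof (intro CollectI allI impI)
      fix i assume i: "Suc i < length (l @ [x])"
      show "Suc i * (l @ [x]) ! i < (l @ [x]) ! Suc i"
      proof (cases "Suc i = length l")
        case True
        then have "l \<noteq> []" by auto
        then have "last l = l ! i" using True last_conv_nth by (metis diff_Suc_1)
        then show ?thesis using x(2) True by (simp add: nth_append)
      next
        case False
        then show ?thesis using l i by (simp add: nth_append P_def)
      qed
    qed
    then show ?thesis using x(1) by blast
  qed
  have long: "\<exists>l'\<in>P. prefix l l' \<and> n \<le> length l'" if "l \<in> P" for l n
  proof (induction n)
    case (Suc n)
    then obtain l' where "l' \<in> P" "prefix l l'" "n \<le> length l'" by blast
    moreover obtain x where "l' @ [x] \<in> P" using ext[OF \<open>l' \<in> P\<close>, of UNIV] by auto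
    ultimately show ?case by (intro bexI[of _ "l' @ [x]"]) (auto intro: prefix_prefix)
  qed (use that in auto)
  have dense: "\<exists>d\<in>D \<inter> P. prefix l d" if Dl: "D \<in> \<D>" "l \<in> P" for D l
  proof -
    obtain E n where E: "infinite E" and D: "D = {l. \<exists>i\<ge>n. i < length l \<and> l ! i \<in> E}"
      using Dl(1) assms(3) unfolding \<D>_def by auto
    obtain l' where l': "l' \<in> P" "prefix l l'" "n \<le> length l'" using long[OF Dl(2)] by blast
    obtain x where x: "x \<in> E" "l' @ [x] \<in> P" using ext[OF l'(1) E] by blast
    have "l' @ [x] \<in> D" using l'(3) x(1) unfolding D by (auto intro!: exI[of _ "length l'"])
    then show ?thesis using x(2) l'(2) by (intro bexI[of _ "l' @ [x]"]) (auto intro: prefix_prefix)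
  qed
  have small: "small \<D>"
  proof -
    have "small (insert UNIV \<E>)"
      using small_Un[OF small_countable[of "{UNIV}"] assms(2)] by simp

    then show ?thesis
      unfolding \<D>_def by (intro small_image small_Times small_countable[of UNIV]) auto
  qed
  have ne: "P \<noteq> {}" by (auto simp: P_def intro!: exI[of _ "[]"])
  have "\<exists>G \<subseteq> P. (\<forall>p\<in>G. \<forall>q\<in>G. \<exists>s\<in>G. prefix p s \<and> prefix q s) \<and> (\<forall>D\<in>\<D>. G \<inter> D \<noteq> {})"
    \<comment> \<open>There are only countably many lists, so \<open>h\<close> can be the
      identity.\<close>
    by (rule martins_axiom_sigma_linked[OF assms(1) ne, where h = "\<lambda>l. l" and le = "\<lambda>p q. prefix q p"])
      (use small dense prefix_order.antisym prefix_order.trans in blast)+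
  then obtain G where G: "G \<subseteq> P" "\<forall>p\<in>G. \<forall>q\<in>G. \<exists>s\<in>G. prefix p s \<and> prefix q s"
    "\<forall>D\<in>\<D>. G \<inter> D \<noteq> {}" by (elim exE conjE)
  have \<D>: "\<exists>l\<in>G. \<exists>i\<ge>n. i < length l \<and> l ! i \<in> E" if "E \<in> insert UNIV \<E>" for E n
  proof -
    have "{l. \<exists>i\<ge>n. i < length l \<and> l ! i \<in> E} \<in> \<D>" using that unfolding \<D>_def by blast
    then have "G \<inter> {l. \<exists>i\<ge>n. i < length l \<and> l ! i \<in> E} \<noteq> {}" using G(3) by (rule bspec[rotated])
    then show ?thesis by blast
  qed
  have "\<forall>n. \<exists>l. l \<in> G \<and> n < length l" using \<D>[of UNIV] by (meson insertI1 le_less_trans)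
  then obtain p where p: "\<And>n. p n \<in> G" "\<And>n. n < length (p n)" by metis
  define z where "z n = p n ! n" for n
  have z: "l ! n = z n" if ln: "l \<in> G" "n < length l" for l n
  proof -
    obtain s where "prefix l s" "prefix (p n) s" using G(2)[rule_format, OF ln(1) p(1)] by blast
    then show ?thesis using ln(2) p(2)[of n] unfolding z_def prefix_def by (metis nth_append)
  qed
  have "Suc n * z n < z (Suc n)" for n
  proof -
    have "p (Suc n) \<in> P" using p(1) G(1) by blast
    then have "Suc n * p (Suc n) ! n < p (Suc n) ! Suc n" using p(2)[of "Suc n"] by (simp add: P_def)
    then show ?thesis using z[OF p(1), of n "Suc n"] z[OF p(1), of "Suc n" "Suc n"] p(2)[of "Suc n"] by simp
  qed
  note thin = thin_range[of z, OF this]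
  moreover have "infinite (range z \<inter> E)" if E: "E \<in> \<E>" for E
    unfolding infinite_nat_iff_unbounded_le
  proof
    fix n
    obtain l i where l: "l \<in> G" "i \<ge> n" "i < length l" "l ! i \<in> E" using \<D>[of E n] E by blast
    then have "z i \<in> range z \<inter> E" using z[of l i] by auto
    moreover have "n \<le> z i" using strict_mono_imp_increasing[OF thin(2), of i] l(2) by simp
    ultimately show "\<exists>m\<ge>n. m \<in> range z \<inter> E" by blast
  qed
  ultimately show ?thesis by blast
qed

section \<open>Contours of cascades\<close>

lemma Least_eq_of_least_strict_bound:
  assumes "least_strict_bound a \<alpha>"
  shows "(LEAST \<beta>. \<forall>n. a n < \<beta>) = \<alpha>"
proof (rule Least_equality)
  show "\<forall>n. a n < \<alpha>" using least_strict_boundD(2)[OF assms] by blast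
  fix \<beta> assume "\<forall>n. a n < \<beta>"
  then show "\<alpha> \<le> \<beta>" using least_strict_boundD(3)[OF assms] by (meson not_le)
qed

lemma least_strict_bound_Least:
  assumes "mono a"
  shows "least_strict_bound a (LEAST \<beta>. \<forall>n. a n < \<beta>)"
proof -
  obtain \<beta> where "\<forall>n. a n < \<beta>" using countable_bounded_omega1[of "range a"] by auto
  then have "\<forall>n. a n < (LEAST \<beta>. \<forall>n. a n < \<beta>)" by (rule LeastI)
  moreover have "\<exists>n. \<beta> \<le> a n" if "\<beta> < (LEAST \<beta>. \<forall>n. a n < \<beta>)" for \<beta>
    using not_less_Least[OF that] by (auto simp: not_less)
  ultimately show ?thesis using assms by (auto simp: least_strict_bound_def)
qed

text \<open>An enumeration without repetition matches the cofinite sets of successors with the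
  cofinite sets of indices.\<close>

lemma filtermap_filter_integral_frechet:
  assumes "bij_betw e (UNIV :: nat set) S"
  shows "filtermap \<phi> (filter_integral (frechet_on S) K) =
    filter_integral sequentially (\<lambda>n. filtermap \<phi> (K (e n)))"
proof -
  have "finite {s \<in> S. \<not> Q s} \<longleftrightarrow> finite {n. \<not> Q (e n)}" for Q
  proof -
    have "{s \<in> S. \<not> Q s} = e ` {n. \<not> Q (e n)}" using assms by (auto simp: bij_betw_def)
    moreover have "inj_on e {n. \<not> Q (e n)}" using assms inj_on_subset unfolding bij_betw_def by blast
    ultimately show ?thesis by (simp add: finite_image_iff)
  qed
  then show ?thesis
    unfolding filter_eq_iff eventually_filtermap eventually_filter_integral eventually_frechet_on
    by (simp add: cofinite_eq_sequentially[symmetric] eventually_cofinite)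
qed

text \<open>Induction along immediate successors. Monotonicity supplies the enumeration with
  nondecreasing ranks for \<open>contour_on.lim\<close>; the tree order shows that the sets of
  leaves above the immediate successors of \<open>v\<close> are disjoint and exhaust the leaves
  above \<open>v\<close>.\<close>

lemma contour_on_contour_at:
  assumes casc: "cascade r" and mono: "monotone_cascade r" and inj: "inj_on \<phi> (max_nodes r)"
    and "v \<in> Field r"
  shows "contour_on (node_rank r v) (\<phi> ` {w \<in> max_nodes r. (v, w) \<in> r}) (filtermap \<phi> (contour_at r v))"
  using wf_succ_rel[OF casc] \<open>v \<in> Field r\<close>
proof (induction v rule: wf_induct_rule)
  case (less v)
  have tree: "tree_order r" using casc unfolding cascade_def by blast
  then have refl: "\<And>x. x \<in> Field r \<Longrightarrow> (x, x) \<in> r" and trans: "trans r"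
    unfolding tree_order_def order_on_defs refl_on_def by auto
  show ?case
  proof (cases "v \<in> max_nodes r")
    case True
    then have "{w \<in> max_nodes r. (v, w) \<in> r} = {v}"
      using refl[OF less.prems] by (auto simp: max_nodes_def aboveS_def)
    then show ?thesis
      using True contour_on.point[of "\<phi> v"]
      by (simp add: node_rank_eq[OF casc] contour_at_eq[OF casc] filtermap_principal)
  next
    case False
    then obtain e :: "nat \<Rightarrow> _" where e: "bij_betw e UNIV (imm_succs r v)"
      and mn: "mono (\<lambda>n. node_rank r (e n))"
      using mono less.prems unfolding monotone_cascade_def by blast
    have range: "range e = imm_succs r v" using e by (simp add: bij_betw_def)
    have imm: "(v, e n) \<in> r" "e n \<noteq> v" "aboveS r v \<inter> underS r (e n) = {}" for n
      using range unfolding imm_succs_def aboveS_def by auto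
    have rank: "node_rank r v = (LEAST \<alpha>. \<forall>n. node_rank r (e n) < \<alpha>)"
      using False node_rank_eq[OF casc, of v] by (simp add: range[symmetric])
    have ctr: "filtermap \<phi> (contour_at r v) =
        filter_integral sequentially (\<lambda>n. filtermap \<phi> (contour_at r (e n)))"
      using False contour_at_eq[OF casc, of v] filtermap_filter_integral_frechet[OF e] by simp
    have "contour_on (node_rank r (e n)) (\<phi> ` {w \<in> max_nodes r. (e n, w) \<in> r})
        (filtermap \<phi> (contour_at r (e n)))" for n
    proof (rule less.IH)
      show "(e n, v) \<in> succ_rel r" using range by (auto simp: succ_rel_def)
      show "e n \<in> Field r" using imm(1) by (rule FieldI2)
    qed
    moreover have "disjoint_family (\<lambda>n. \<phi> ` {w \<in> max_nodes r. (e n, w) \<in> r})"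
      unfolding disjoint_family_on_def
    proof (intro ballI impI, rule ccontr)
      fix m n assume "m \<noteq> n"
        "\<phi> ` {w \<in> max_nodes r. (e m, w) \<in> r} \<inter> \<phi> ` {w \<in> max_nodes r. (e n, w) \<in> r} \<noteq> {}"
      then obtain w w' where w: "w \<in> max_nodes r" "w' \<in> max_nodes r" "(e m, w) \<in> r" "(e n, w') \<in> r" "\<phi> w = \<phi> w'"
        by blast
      then have "w = w'" using inj by (auto dest: inj_onD)
      have ne: "e m \<noteq> e n" using e \<open>m \<noteq> n\<close> by (auto simp: bij_betw_def dest: injD)
      \<comment> \<open>The nodes below a leaf form a chain. Two immediate successors of
        \<open>v\<close> below the same leaf would be comparable, and one of them would lie strictly
        between \<open>v\<close> and the other.\<close>
      have "total_on (under r w) (Restr r (under r w))"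
        using tree FieldI2[OF w(3)] unfolding tree_order_def order_on_defs by blast
      then have "(e m, e n) \<in> r \<or> (e n, e m) \<in> r"
        using ne w(3,4) \<open>w = w'\<close> unfolding total_on_def under_def by blast
      then have "e m \<in> aboveS r v \<inter> underS r (e n) \<or> e n \<in> aboveS r v \<inter> underS r (e m)"
        using imm(1,2)[of m] imm(1,2)[of n] ne by (auto simp: aboveS_def underS_def)
      then show False using imm(3)[of m] imm(3)[of n] by simp
    qed
    moreover note least_strict_bound_Least[OF mn, folded rank]
    ultimately have "contour_on (node_rank r v) (\<Union>n. \<phi> ` {w \<in> max_nodes r. (e n, w) \<in> r})
        (filtermap \<phi> (contour_at r v))"
      unfolding ctr by (rule contour_on.lim)
    moreover have "{w \<in> max_nodes r. (v, w) \<in> r} = (\<Union>n. {w \<in> max_nodes r. (e n, w) \<in> r})"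
    proof (intro equalityI subsetI)
      fix w assume "w \<in> {w \<in> max_nodes r. (v, w) \<in> r}"
      then have w: "w \<in> max_nodes r" "(v, w) \<in> r" by auto
      \<comment> \<open>A minimal node among those that are above \<open>v\<close> and not above
        \<open>w\<close> in the tree's chain below \<open>w\<close> is the immediate successor of
        \<open>v\<close> leading to \<open>w\<close>.\<close>
      define R where "R = Restr r (under r w) - Id"
      have "wf R"
        using tree FieldI2[OF w(2)] unfolding tree_order_def well_order_on_def R_def by blast
      moreover have "w \<in> aboveS r v \<inter> under r w"
        using w False refl[OF FieldI2[OF w(2)]] by (auto simp: aboveS_def under_def)
      ultimately obtain m where m: "m \<in> aboveS r v \<inter> under r w"
        and min: "\<And>y. (y, m) \<in> R \<Longrightarrow> y \<notin> aboveS r v \<inter> under r w"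
        by (rule wfE_min) (rule that)
      have "aboveS r v \<inter> underS r m = {}"
      proof (rule ccontr)
        assume "aboveS r v \<inter> underS r m \<noteq> {}"
        then obtain y where y: "y \<in> aboveS r v" "y \<noteq> m" "(y, m) \<in> r" by (auto simp: underS_def)
        then have "y \<in> under r w" using m transD[OF trans] unfolding under_def by blast
        then show False using min[of y] y m unfolding R_def by auto
      qed
      then have "m \<in> range e" using m unfolding range imm_succs_def by blast
      then show "w \<in> (\<Union>n. {w \<in> max_nodes r. (e n, w) \<in> r})" using m w(1) by (auto simp: under_def)
    next
      fix w assume "w \<in> (\<Union>n. {w \<in> max_nodes r. (e n, w) \<in> r})"
      then show "w \<in> {w \<in> max_nodes r. (v, w) \<in> r}" using imm(1) transD[OF trans] by blast
    qed
    then have "\<phi> ` {w \<in> max_nodes r. (v, w) \<in> r} = (\<Union>n. \<phi> ` {w \<in> max_nodes r. (e n, w) \<in> r})"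
      by (simp add: image_UN)
    ultimately show ?thesis by simp
  qed
qed

lemma root_least_node:
  assumes "antisym r" "least_node r b"
  shows "root r = b"
  unfolding root_def using assms by (intro the_equality) (auto simp: least_node_def dest: antisymD)

lemma contour_on_contour:
  assumes "cascade r" "monotone_cascade r" "inj_on \<phi> (max_nodes r)"
  shows "\<exists>D. contour_on (cascade_rank r) D (filtermap \<phi> (contour r))"
proof -
  obtain b where b: "least_node r b" using assms(1) unfolding cascade_def by blast
  have "antisym r" using assms(1) unfolding cascade_def tree_order_def order_on_defs by blast
  then have "root r \<in> Field r" using root_least_node[OF _ b] b by (simp add: least_node_def)
  from contour_on_contour_at[OF assms this] show ?thesis
    unfolding cascade_rank_def contour_def by blast
qed

text \<open>
  A cascade is coded by the tree \<open>T\<close> of the addresses of its nodes. The labels \<open>\<rho>\<close>, \<open>\<Phi>\<close> and \<open>x\<close>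
  are the ranks of the nodes, the contours at the nodes and the points attached to the leaves.
\<close>

definition leaves :: "nat list set \<Rightarrow> nat list set" where
  "leaves T = {s \<in> T. \<forall>n. s @ [n] \<notin> T}"

definition labelled_tree ::
  "nat list set \<Rightarrow> (nat list \<Rightarrow> omega1) \<Rightarrow> (nat list \<Rightarrow> nat filter) \<Rightarrow> (nat list \<Rightarrow> nat) \<Rightarrow> bool" where
  "labelled_tree T \<rho> \<Phi> x \<longleftrightarrow> [] \<in> T \<and> (\<forall>s n. s @ [n] \<in> T \<longrightarrow> s \<in> T) \<and>
    (\<forall>g. \<exists>n. map g [0..<n] \<notin> T) \<and> inj_on x (leaves T) \<and>
    (\<forall>s\<in>leaves T. \<rho> s = 0 \<and> \<Phi> s = principal {x s}) \<and>
    (\<forall>s\<in>T - leaves T. (\<forall>n. s @ [n] \<in> T) \<and> least_strict_bound (\<lambda>n. \<rho> (s @ [n])) (\<rho> s) \<and>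
      \<Phi> s = filter_integral sequentially (\<lambda>n. \<Phi> (s @ [n])))"

lemma labelled_treeD:
  assumes "labelled_tree T \<rho> \<Phi> x"
  shows "[] \<in> T" "s @ [n] \<in> T \<Longrightarrow> s \<in> T" "\<exists>n. map g [0..<n] \<notin> T" "inj_on x (leaves T)"
    "s \<in> leaves T \<Longrightarrow> \<rho> s = 0" "s \<in> leaves T \<Longrightarrow> \<Phi> s = principal {x s}"
    "s \<in> T - leaves T \<Longrightarrow> s @ [n] \<in> T"
    "s \<in> T - leaves T \<Longrightarrow> least_strict_bound (\<lambda>n. \<rho> (s @ [n])) (\<rho> s)"
    "s \<in> T - leaves T \<Longrightarrow> \<Phi> s = filter_integral sequentially (\<lambda>n. \<Phi> (s @ [n]))"
  using assms unfolding labelled_tree_def by blast+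

text \<open>The trees of the pieces are hung below a new root, the \<open>n\<close>-th one with
  \<open>n\<close> put in front of its addresses. Disjointness of the pieces keeps the points at the
  leaves distinct.\<close>

lemma ex_labelled_tree:
  assumes "contour_on \<alpha> D F"
  shows "\<exists>T \<rho> \<Phi> x. labelled_tree T \<rho> \<Phi> x \<and> \<rho> [] = \<alpha> \<and> \<Phi> [] = F \<and> x ` leaves T = D"
  using assms
proof (induction rule: contour_on.induct)
  case (point y)
  have "leaves {[]} = {[]}" by (auto simp: leaves_def)
  moreover have "\<exists>n. map g [0..<n] \<notin> {[]}" for g :: "nat \<Rightarrow> nat" by (rule exI[of _ 1]) simp
  ultimately show ?case
    by (intro exI[of _ "{[]}"] exI[of _ "\<lambda>_. 0"] exI[of _ "\<lambda>_. principal {y}"] exI[of _ "\<lambda>_. y"])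
      (simp add: labelled_tree_def)
next
  case (lim a D F \<alpha>)
  have "\<forall>n. \<exists>T \<rho> \<Phi> x. labelled_tree T \<rho> \<Phi> x \<and> \<rho> [] = a n \<and> \<Phi> [] = F n \<and> x ` leaves T = D n"
    using lim.IH by blast
  then obtain T \<rho> \<Phi> x where lt: "\<And>n. labelled_tree (T n) (\<rho> n) (\<Phi> n) (x n)"
    and root: "\<And>n. \<rho> n [] = a n" "\<And>n. \<Phi> n [] = F n" and D: "\<And>n. x n ` leaves (T n) = D n"
    by metis
  define T' where "T' = insert [] {n # s | n s. s \<in> T n}"
  define \<rho>' where "\<rho>' s = (case s of [] \<Rightarrow> \<alpha> | n # t \<Rightarrow> \<rho> n t)" for s
  define \<Phi>' where "\<Phi>' s = (case s of [] \<Rightarrow> filter_integral sequentially F | n # t \<Rightarrow> \<Phi> n t)" for s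
  \<comment> \<open>The new root is not a leaf, so its value 0 is a mere default.\<close>
  define x' where "x' s = (case s of [] \<Rightarrow> 0 | n # t \<Rightarrow> x n t)" for s
  have T'[simp]: "[] \<in> T'" "n # s \<in> T' \<longleftrightarrow> s \<in> T n" for n s by (auto simp: T'_def)
  note ltD = labelled_treeD[OF lt]
  have nil: "[] \<in> T n" for n by (rule ltD)
  have leaf: "[] \<notin> leaves T'" "n # s \<in> leaves T' \<longleftrightarrow> s \<in> leaves (T n)" for n s
    using nil by (auto simp: leaves_def)
  have leaves: "leaves T' = (\<Union>n. Cons n ` leaves (T n))"
  proof (intro equalityI subsetI)
    fix s assume "s \<in> leaves T'"
    then show "s \<in> (\<Union>n. Cons n ` leaves (T n))" using leaf by (cases s) auto
  qed (use leaf in auto)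
  have "labelled_tree T' \<rho>' \<Phi>' x'"
    unfolding labelled_tree_def
  proof (intro conjI allI ballI impI)
    fix s n assume "s @ [n] \<in> T'"
    then show "s \<in> T'" by (cases s) (auto dest: ltD(2))
  next
    fix g :: "nat \<Rightarrow> nat"
    obtain n where n: "map (\<lambda>i. g (Suc i)) [0..<n] \<notin> T (g 0)" using ltD(3) by blast
    \<comment> \<open>After its first step, a path through \<open>T'\<close> is a path through
      \<open>T (g 0)\<close>.\<close>
    have "map g [0..<Suc n] = g 0 # map (\<lambda>i. g (Suc i)) [0..<n]"
      by (simp add: upt_conv_Cons map_Suc_upt[symmetric] del: upt_Suc)
    then show "\<exists>n. map g [0..<n] \<notin> T'" using n T'(2) by metis
  next
    show "inj_on x' (leaves T')"
    proof (rule inj_onI)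
      fix s t assume s: "s \<in> leaves T'" and t: "t \<in> leaves T'" and eq: "x' s = x' t"
      obtain m s' where s': "s = m # s'" "s' \<in> leaves (T m)" using s leaves by auto
      obtain n t' where t': "t = n # t'" "t' \<in> leaves (T n)" using t leaves by auto
      have "x m s' \<in> D m" "x n t' \<in> D n" using D s'(2) t'(2) by blast+
      then have "m = n"
        using eq disjoint_family_onD[OF lim.hyps(2), of m n] by (auto simp: x'_def s' t')
      then show "s = t"
        using eq s' t' inj_onD[OF ltD(4)] by (auto simp: x'_def)
    qed
  next
    fix s assume "s \<in> leaves T'"
    then obtain m s' where s': "s = m # s'" "s' \<in> leaves (T m)" using leaves by auto
    then show "\<rho>' s = 0" "\<Phi>' s = principal {x' s}"
      using ltD(5,6) by (auto simp: \<rho>'_def \<Phi>'_def x'_def)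
  next
    fix s assume s: "s \<in> T' - leaves T'"
    have "(\<forall>n. s @ [n] \<in> T') \<and> least_strict_bound (\<lambda>n. \<rho>' (s @ [n])) (\<rho>' s) \<and>
      \<Phi>' s = filter_integral sequentially (\<lambda>n. \<Phi>' (s @ [n]))"
    proof (cases s)
      case Nil
      then show ?thesis using nil lim.hyps(3) root by (simp add: \<rho>'_def \<Phi>'_def)
    next
      case (Cons m s')
      then have "s' \<in> T m - leaves (T m)" using s leaf by simp
      then show ?thesis
        using ltD(7-9)[of s' m] by (simp add: Cons \<rho>'_def \<Phi>'_def)
    qed
    then show "s @ [n] \<in> T'" "least_strict_bound (\<lambda>n. \<rho>' (s @ [n])) (\<rho>' s)"
      "\<Phi>' s = filter_integral sequentially (\<lambda>n. \<Phi>' (s @ [n]))" for n by blast+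
  qed simp
  moreover have "x' ` leaves T' = (\<Union>n. D n)"
    using D by (auto simp: leaves x'_def image_iff) blast+
  moreover have "\<rho>' [] = \<alpha>" "\<Phi>' [] = filter_integral sequentially F"
    by (simp_all add: \<rho>'_def \<Phi>'_def)
  ultimately show ?case by blast
qed

text \<open>The addresses of a labelled tree, coded as numbers and ordered by prefix, form a
  cascade. Induction along immediate successors identifies its recursively defined ranks and
  contours with the labels.\<close>

lemma monotone_sequential_contour_of_contour_on:
  assumes "contour_on \<alpha> D F"
  shows "monotone_sequential_contour \<alpha> F"
proof -
  obtain T \<rho> \<Phi> x where lt: "labelled_tree T \<rho> \<Phi> x" and root: "\<rho> [] = \<alpha>" "\<Phi> [] = F"
    using ex_labelled_tree[OF assms] by blast
  note ltD = labelled_treeD[OF lt]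
  have closed: "s \<in> T" if "prefix s t" "t \<in> T" for s t
  proof -
    have "s @ u \<in> T \<Longrightarrow> s \<in> T" for u
      by (induction u rule: rev_induct) (auto simp: append_assoc[symmetric] simp del: append_assoc dest: ltD(2))
    then show ?thesis using that by (auto simp: prefix_def)
  qed
  have between: "\<exists>n. s @ [n] \<in> T \<and> prefix (s @ [n]) t" if st: "prefix s t" "s \<noteq> t" "t \<in> T" for s t
  proof -
    obtain u where "t = s @ u" using st(1) by (auto simp: prefix_def)
    then obtain n u' where "t = s @ n # u'" using st(2) by (cases u) auto
    then have "prefix (s @ [n]) t" by (simp add: prefix_def)
    then show ?thesis using closed st(3) by blast
  qed
  note list_encode.simps [simp del]
  let ?c = list_encode
  define r where "r = {(?c s, ?c t) | s t. s \<in> T \<and> t \<in> T \<and> prefix s t}"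
  have r: "(?c s, ?c t) \<in> r \<longleftrightarrow> s \<in> T \<and> t \<in> T \<and> prefix s t" for s t
    unfolding r_def by (auto simp: list_encode_eq)
  have rE: "\<exists>s t. v = ?c s \<and> w = ?c t \<and> s \<in> T \<and> t \<in> T \<and> prefix s t" if "(v, w) \<in> r" for v w
    using that unfolding r_def by blast
  have F: "Field r = ?c ` T" unfolding Field_def r_def by auto
  have above: "aboveS r (?c s) = ?c ` {t \<in> T. prefix s t \<and> t \<noteq> s}" if "s \<in> T" for s
    using that unfolding aboveS_def r_def by (auto simp: list_encode_eq)
  have under: "underS r (?c s) = ?c ` {t \<in> T. prefix t s \<and> t \<noteq> s}" if "s \<in> T" for s
    using that unfolding underS_def r_def by (auto simp: list_encode_eq)
  have po: "refl_on (Field r) r" "trans r" "antisym r" "r \<subseteq> Field r \<times> Field r"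
    by (auto simp: refl_on_def r F Field_def r_def list_encode_eq intro!: transI antisymI
      intro: prefix_order.trans prefix_order.antisym)
  have wfr: "wf (Restr r A - Id)" for A
  proof (rule wf_subset)
    show "wf (inv_image less_than (\<lambda>v. length (list_decode v)))" by simp
    show "Restr r A - Id \<subseteq> inv_image less_than (\<lambda>v. length (list_decode v))"
      by (auto simp: r_def strict_prefix_def intro!: prefix_length_less)
  qed
  have "tree_order r"
    unfolding tree_order_def well_order_on_def
  proof (intro conjI ballI)
    show "Partial_order r" using po unfolding order_on_defs by blast
    fix v assume "v \<in> Field r"
    have "(a, b) \<in> r \<or> (b, a) \<in> r" if "(a, v) \<in> r" "(b, v) \<in> r" for a b
      using that by (auto simp: r_def list_encode_eq dest: prefix_same_cases)
    moreover have "(a, a) \<in> r" if "(a, v) \<in> r" for a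
      using that po(1) unfolding refl_on_def by (auto intro: FieldI1)
    ultimately show "linear_order_on (under r v) (Restr r (under r v))"
      using po unfolding order_on_defs
      by (auto simp: refl_on_def total_on_def under_def trans_Restr antisym_Restr)
    show "wf (Restr r (under r v) - Id)" by (rule wfr)
  qed
  moreover have "finite C" if "branch r C" for C
  proof (rule ccontr)
    assume "infinite C"
    \<comment> \<open>A chain of addresses has at most one member of each length. If it is infinite,
      its members are initial segments of one sequence \<open>g\<close>, which contradicts the
      absence of infinite paths in \<open>T\<close>.\<close>
    define L where "L = list_decode ` C"
    have C: "C \<in> Chains r" using that by (simp add: branch_def)
    have cmp: "s \<in> T \<and> (prefix s t \<or> prefix t s)" if st: "s \<in> L" "t \<in> L" for s t
    proof -
      have "?c s \<in> C" "?c t \<in> C" using st by (auto simp: L_def)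
      then have "(?c s, ?c t) \<in> r \<or> (?c t, ?c s) \<in> r" using C unfolding Chains_def by blast
      then show ?thesis unfolding r by blast
    qed
    have "infinite L" using \<open>infinite C\<close> unfolding L_def
      by (metis finite_imageD inj_list_decode inj_on_subset subset_UNIV)
    have inj_len: "inj_on length L"
    proof (rule inj_onI)
      fix s t assume "s \<in> L" "t \<in> L" "length s = length t"
      then show "s = t" using cmp[of s t] by (auto simp: prefix_def)
    qed
    have "\<exists>l\<in>L. n < length l" for n
    proof (rule ccontr)
      assume "\<not> ?thesis"
      then have "length ` L \<subseteq> {..n}" by (auto simp: not_less)
      then show False using \<open>infinite L\<close> inj_len finite_imageD finite_subset by blast
    qed
    then obtain l where l: "\<And>n. l n \<in> L" "\<And>n. n < length (l n)" by metis
    define g where "g n = l n ! n" for n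
    have "map g [0..<n] = take n (l n)" for n
    proof (rule nth_equalityI)
      fix i assume "i < length (map g [0..<n])"
      then have i: "i < n" by simp
      have "l i ! i = l n ! i"
        using cmp[OF l(1) l(1), of i n] l(2)[of i] l(2)[of n] i by (auto simp: prefix_def nth_append)
      then show "map g [0..<n] ! i = take n (l n) ! i" using i by (simp add: g_def)
    qed (use l(2)[of n] in simp)
    moreover have "take n (l n) \<in> T" for n
      using closed[OF take_is_prefix] cmp[OF l(1) l(1)] by blast
    ultimately show False using ltD(3)[of g] by simp
  qed
  moreover have least: "least_node r (?c [])" using ltD(1) by (auto simp: least_node_def F r)
  ultimately have casc: "cascade r" unfolding cascade_def by blast
  have rt: "Defs.root r = ?c []" using root_least_node[OF po(3) least] .
  have maxn: "max_nodes r = ?c ` leaves T"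
  proof -
    have "?c s \<in> max_nodes r \<longleftrightarrow> s \<in> leaves T" if s: "s \<in> T" for s
    proof -
      have "{t \<in> T. prefix s t \<and> t \<noteq> s} = {} \<longleftrightarrow> (\<forall>n. s @ [n] \<notin> T)"
        using between[of s] by (auto simp: prefix_def)
      then show ?thesis using s above[OF s] by (auto simp: max_nodes_def F leaves_def)
    qed
    then show ?thesis using F by (auto simp: max_nodes_def leaves_def)
  qed
  have imm: "imm_succs r (?c s) = range (\<lambda>n. ?c (s @ [n]))" if s: "s \<in> T - leaves T" for s
  proof (intro equalityI subsetI)
    fix w assume "w \<in> imm_succs r (?c s)"
    then obtain t where t: "w = ?c t" "t \<in> T" "prefix s t" "t \<noteq> s"
      and e: "aboveS r (?c s) \<inter> underS r (?c t) = {}"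
      using above[of s] s unfolding imm_succs_def by auto
    obtain n where n: "s @ [n] \<in> T" "prefix (s @ [n]) t" using between[of s t] t by auto
    have "?c (s @ [n]) \<in> aboveS r (?c s)" using s n(1) by (simp add: above)
    then have "?c (s @ [n]) \<notin> underS r (?c t)" using e by blast
    then have "s @ [n] = t" using n t(2) by (auto simp: under)
    then show "w \<in> range (\<lambda>n. ?c (s @ [n]))" using t(1) by blast
  next
    fix w assume "w \<in> range (\<lambda>n. ?c (s @ [n]))"
    then obtain n where w: "w = ?c (s @ [n])" by blast
    have sn: "s @ [n] \<in> T" using ltD(7)[OF s] .
    have "aboveS r (?c s) \<inter> underS r (?c (s @ [n])) = {}"
      using s sn by (auto simp: above under list_encode_eq dest: prefix_order.antisym)
    then show "w \<in> imm_succs r (?c s)" using s sn by (auto simp: imm_succs_def w above)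
  qed
  have bij: "bij_betw (\<lambda>n. ?c (s @ [n])) UNIV (imm_succs r (?c s))" if "s \<in> T - leaves T" for s
    unfolding imm[OF that] bij_betw_def by (auto simp: inj_def list_encode_eq)
  have nonmax: "\<exists>s\<in>T - leaves T. v = ?c s" if "v \<in> Field r - max_nodes r" for v
    using that unfolding F maxn by blast
  have labels: "node_rank r (?c s) = \<rho> s \<and> filtermap (x \<circ> list_decode) (contour_at r (?c s)) = \<Phi> s"
    if "s \<in> T" for s
    using wf_succ_rel[OF casc] that
  proof (induction "?c s" arbitrary: s rule: wf_induct_rule)
    case less
    show ?case
    proof (cases "s \<in> leaves T")
      case True
      then have "?c s \<in> max_nodes r" using maxn by blast
      then show ?thesis
        using ltD(5,6)[OF True] by (simp add: node_rank_eq[OF casc] contour_at_eq[OF casc] filtermap_principal)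
    next
      case False
      then have s: "s \<in> T - leaves T" using less.prems by blast
      then have nm: "?c s \<notin> max_nodes r" unfolding maxn by (auto simp: list_encode_eq)
      have IH: "node_rank r (?c (s @ [n])) = \<rho> (s @ [n])"
        "filtermap (x \<circ> list_decode) (contour_at r (?c (s @ [n]))) = \<Phi> (s @ [n])" for n
        using less.hyps[of "s @ [n]"] ltD(7)[OF s] imm[OF s] by (auto simp: succ_rel_def)
      have "node_rank r (?c s) = \<rho> s"
        using Least_eq_of_least_strict_bound[OF ltD(8)[OF s]] nm
        by (simp add: node_rank_eq[OF casc, of "?c s"] imm[OF s] IH)
      moreover have "filtermap (x \<circ> list_decode) (contour_at r (?c s)) = \<Phi> s"
        using nm by (simp add: contour_at_eq[OF casc, of "?c s"] filtermap_filter_integral_frechet[OF bij[OF s]] IH ltD(9)[OF s])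
      ultimately show ?thesis ..
    qed
  qed
  have "sequential r"
    unfolding sequential_def
  proof
    fix v assume "v \<in> Field r - max_nodes r"
    then obtain s where s: "s \<in> T - leaves T" "v = ?c s" using nonmax by blast
    show "countable (imm_succs r v) \<and> infinite (imm_succs r v)"
      using bij_betw_finite[OF bij[OF s(1)]] by (simp add: s(2) imm[OF s(1)])
  qed
  moreover have "monotone_cascade r"
    unfolding monotone_cascade_def
  proof
    fix v assume "v \<in> Field r - max_nodes r"
    then obtain s where s: "s \<in> T - leaves T" "v = ?c s" using nonmax by blast
    have "mono (\<lambda>n. node_rank r (?c (s @ [n])))"
      using least_strict_boundD(1)[OF ltD(8)[OF s(1)]] labels ltD(7)[OF s(1)] by simp
    then show "\<exists>e :: nat \<Rightarrow> nat. bij_betw e UNIV (imm_succs r v) \<and> mono (\<lambda>n. node_rank r (e n))"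
      using bij[OF s(1)] s(2) by blast
  qed
  moreover have "cascade_rank r = \<alpha>" using labels[OF ltD(1)] root rt by (simp add: cascade_rank_def)
  moreover have "inj_on (x \<circ> list_decode) (max_nodes r)"
    using ltD(4) unfolding maxn by (auto simp: inj_on_def)
  moreover have "F = filtermap (x \<circ> list_decode) (contour r)"
    using labels[OF ltD(1)] root rt by (simp add: contour_def)
  ultimately show ?thesis using casc unfolding monotone_sequential_contour_def by blast
qed

section \<open>The generic construction\<close>

text \<open>That \<open>generated F \<B>\<close> differs from \<open>bot\<close> expresses
  consistency: every finite intersection of members of \<open>\<B>\<close> is positive for
  \<open>F\<close>.\<close>

definition generated :: "'a filter \<Rightarrow> 'a set set \<Rightarrow> 'a filter" where
  "generated F \<B> = inf F (INF B\<in>\<B>. principal B)"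

lemma eventually_generated:
  "eventually P (generated F \<B>) \<longleftrightarrow>
    (\<exists>\<C>. finite \<C> \<and> \<C> \<subseteq> \<B> \<and> eventually (\<lambda>x. x \<in> \<Inter>\<C> \<longrightarrow> P x) F)"
proof
  assume "eventually P (generated F \<B>)"
  then obtain Q R where Q: "eventually Q F" and R: "eventually R (INF B\<in>\<B>. principal B)"
    and QR: "\<And>x. Q x \<Longrightarrow> R x \<Longrightarrow> P x"
    unfolding generated_def eventually_inf by blast
  obtain \<C> where \<C>: "finite \<C>" "\<C> \<subseteq> \<B>" "eventually R (INF B\<in>\<C>. principal B)"
    using iffD1[OF eventually_INF R] by blast
  have "\<forall>x\<in>\<Inter>\<C>. R x"
    using \<C>(3) INF_principal_finite[OF \<C>(1), of "\<lambda>B. B"] by (simp add: eventually_principal)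
  with Q QR have "eventually (\<lambda>x. x \<in> \<Inter>\<C> \<longrightarrow> P x) F" by (auto elim: eventually_mono)
  then show "\<exists>\<C>. finite \<C> \<and> \<C> \<subseteq> \<B> \<and> eventually (\<lambda>x. x \<in> \<Inter>\<C> \<longrightarrow> P x) F" using \<C> by blast
next
  assume "\<exists>\<C>. finite \<C> \<and> \<C> \<subseteq> \<B> \<and> eventually (\<lambda>x. x \<in> \<Inter>\<C> \<longrightarrow> P x) F"
  then obtain \<C> where \<C>: "finite \<C>" "\<C> \<subseteq> \<B>" "eventually (\<lambda>x. x \<in> \<Inter>\<C> \<longrightarrow> P x) F" by blast
  have "generated F \<B> \<le> inf F (INF B\<in>\<C>. principal B)"
    unfolding generated_def using \<C>(2) by (intro inf_mono INF_superset_mono) auto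
  also have "\<dots> = inf F (principal (\<Inter>\<C>))"
    using INF_principal_finite[OF \<C>(1), of "\<lambda>B. B"] by simp
  finally show "eventually P (generated F \<B>)"
    using \<C>(3) unfolding le_filter_def eventually_inf_principal by blast
qed

lemma generated_insert: "generated F (insert U \<B>) = inf (generated F \<B>) (principal U)"
  by (simp add: generated_def inf_commute inf_left_commute)

lemma generated_insert_neq_bot:
  "generated F (insert U \<B>) \<noteq> bot \<longleftrightarrow> (\<exists>\<^sub>F x in generated F \<B>. x \<in> U)"
  by (simp add: generated_insert trivial_limit_def eventually_inf_principal frequently_def)

lemma eventually_INF_decseq:
  assumes "decseq (F :: nat \<Rightarrow> 'a filter)"
  shows "eventually P (INF i. F i) \<longleftrightarrow> (\<exists>i. eventually P (F i))"
proof -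
  have "eventually P (INF i. F i) \<longleftrightarrow> (\<exists>i\<in>UNIV. eventually P (F i))"
  proof (rule eventually_INF_base)
    fix i j :: nat
    show "\<exists>k\<in>UNIV. F k \<le> inf (F i) (F j)"
      using decseqD[OF assms, of i "max i j"] decseqD[OF assms, of j "max i j"]
      by (intro bexI[of _ "max i j"]) auto
  qed auto
  then show ?thesis by simp
qed

text \<open>Splits positivity into one requirement for each finite intersection \<open>B\<close> and
  each \<open>i\<close>. For small \<open>\<B>\<close> these are fewer than
  \<open>2\<^sup>\<omega>\<close> requirements, each about a single filter
  \<open>F i\<close>.\<close>

lemma frequently_generated_INF:
  assumes "decseq (F :: nat \<Rightarrow> 'a filter)"
  shows "(\<exists>\<^sub>F x in generated (INF i. F i) \<B>. P x) \<longleftrightarrow>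
    (\<forall>B\<in>{\<Inter>\<C> | \<C>. finite \<C> \<and> \<C> \<subseteq> \<B>}. \<forall>i. \<exists>\<^sub>F x in F i. x \<in> B \<and> P x)"
  unfolding frequently_def eventually_generated eventually_INF_decseq[OF assms] imp_conv_disj de_Morgan_conj
  by blast

section \<open>Transfinite recursion over the tasks\<close>

lemma lesspoll_iff_card_of_ordLess: "A \<prec> B \<longleftrightarrow> ordLess2 (card_of A) (card_of B)"
proof -
  have "A \<prec> B \<longleftrightarrow> \<not> B \<lesssim> A"
    using ordLeq_total[OF card_of_Well_order card_of_Well_order, of A B] lepoll_antisym
    unfolding lesspoll_def lepoll_iff_card_of_ordLeq[symmetric]
    by (metis eqpoll_imp_lepoll eqpoll_sym)
  then show ?thesis
    unfolding lepoll_iff_card_of_ordLeq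
    using not_ordLeq_iff_ordLess[OF card_of_Well_order card_of_Well_order] by blast
qed

text \<open>Inconsistency already shows in finitely many sets, and finitely many indices lie in the
  initial segment up to the greatest of them.\<close>

lemma generated_neq_bot_of_initial_segments:
  assumes W: "Linear_order W" "Field W = UNIV" and "F \<noteq> bot"
    and T: "\<And>t. t \<in> T \<Longrightarrow> generated F (U ` insert t (underS W t)) \<noteq> bot"
  shows "generated F (U ` T) \<noteq> bot"
proof
  have tot: "(s, t) \<in> W \<or> (t, s) \<in> W" for s t
    using W unfolding order_on_defs total_on_def refl_on_def by (metis UNIV_I)
  have trans: "(s, t) \<in> W" if "(s, m) \<in> W" "(m, t) \<in> W" for s m t
    using W that unfolding order_on_defs trans_def by blast
  have max: "\<exists>m\<in>S. \<forall>s\<in>S. (s, m) \<in> W" if "finite S" "S \<noteq> {}" for S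
    using that
  proof (induction S rule: finite_ne_induct)
    case (insert x S)
    then obtain m where m: "m \<in> S" "\<forall>s\<in>S. (s, m) \<in> W" by blast
    have "\<forall>s\<in>insert x S. (s, x) \<in> W" if "(m, x) \<in> W"
      using m(2) that tot[of x x] trans by blast
    then show ?case using m tot[of m x] by blast
  qed (use tot in blast)
  assume "generated F (U ` T) = bot"
  then have "eventually (\<lambda>_. False) (generated F (U ` T))" by simp
  then obtain \<C> where \<C>: "finite \<C>" "\<C> \<subseteq> U ` T" "eventually (\<lambda>x. x \<notin> \<Inter>\<C>) F"
    unfolding eventually_generated by auto
  obtain S where S: "finite S" "S \<subseteq> T" "\<C> = U ` S" using finite_subset_image[OF \<C>(1,2)] by blast
  have "S \<noteq> {}"
    using \<C>(3) \<open>F \<noteq> bot\<close> S(3) by (auto simp: trivial_limit_def)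
  then obtain m where m: "m \<in> S" "\<forall>s\<in>S. (s, m) \<in> W" using max S(1) by blast
  have "\<C> \<subseteq> U ` insert m (underS W m)" using m(2) S(3) by (auto simp: underS_def)
  then have "eventually (\<lambda>_. False) (generated F (U ` insert m (underS W m)))"
    unfolding eventually_generated using \<C>(1,3) by auto
  then show False using T[of m] m(1) S(2) by (auto simp: trivial_limit_def)
qed

text \<open>Here \<open>R t U\<close> says that \<open>U\<close> fulfils task \<open>t\<close>, and
  \<open>h\<close> bounds the number of tasks by \<open>2\<^sup>\<omega>\<close>. A set for each
  task is chosen by recursion along a wellorder of the tasks, keeping the generated filter
  proper.\<close>

lemma ex_generic_filter:
  fixes R :: "'t \<Rightarrow> 'a set \<Rightarrow> bool" and h :: "'t \<Rightarrow> nat set"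
  assumes "inj h" "F \<noteq> bot"
    and step: "\<And>t \<B>. small \<B> \<Longrightarrow> generated F \<B> \<noteq> bot \<Longrightarrow> \<exists>U. R t U \<and> generated F (insert U \<B>) \<noteq> bot"
  shows "\<exists>u. u \<noteq> bot \<and> u \<le> F \<and> (\<forall>t. \<exists>U. R t U \<and> eventually (\<lambda>x. x \<in> U) u)"
proof -
  \<comment> \<open>A wellorder of minimal type: the tasks before a given one are fewer than all
    tasks, hence fewer than \<open>2\<^sup>\<omega>\<close>, and \<open>step\<close> applies to the
    sets chosen for them.\<close>
  define W where "W = card_of (UNIV :: 't set)"
  have wo: "Well_order W" unfolding W_def by (rule card_of_Well_order)
  have F: "Field W = UNIV" by (simp add: W_def Field_card_of)
  have lin: "Linear_order W" and wf: "wf (W - Id)" using wo unfolding well_order_on_def by auto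
  define U where "U = wfrec (W - Id)
    (\<lambda>g t. SOME V. R t V \<and> generated F (insert V (g ` underS W t)) \<noteq> bot)"
  have U: "U t = (SOME V. R t V \<and> generated F (insert V (U ` underS W t)) \<noteq> bot)" for t
  proof -
    have "cut U (W - Id) t ` underS W t = U ` underS W t"
      by (intro image_cong) (auto simp: cut_apply underS_def)
    then show ?thesis by (subst def_wfrec[OF eq_reflection[OF U_def] wf]) simp
  qed
  have small: "small (U ` underS W t)" for t
  proof -
    have "ordLess2 (card_of (underS W t)) W"
      using card_of_underS[of W t] F by (simp add: W_def card_of_Card_order)
    then have "underS W t \<prec> (UNIV :: 't set)" by (simp add: lesspoll_iff_card_of_ordLess W_def)
    also have "(UNIV :: 't set) \<lesssim> (UNIV :: nat set set)" using \<open>inj h\<close> by (auto simp: lepoll_def)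
    finally show ?thesis by (rule small_image)
  qed
  have main: "R t (U t) \<and> generated F (U ` insert t (underS W t)) \<noteq> bot" for t
    using wf
  proof (induction t rule: wf_induct_rule)
    case (less t)
    have "generated F (U ` underS W t) \<noteq> bot"
      by (rule generated_neq_bot_of_initial_segments[OF lin F \<open>F \<noteq> bot\<close>])
        (use less in \<open>auto simp: underS_def\<close>)
    from someI_ex[OF step[OF small this, of t]] show ?case unfolding U[of t, symmetric] by simp
  qed
  show ?thesis
  proof (intro exI[of _ "generated F (range U)"] conjI allI)
    show "generated F (range U) \<noteq> bot"
      using generated_neq_bot_of_initial_segments[OF lin F \<open>F \<noteq> bot\<close>, of UNIV U] main by simp
    show "generated F (range U) \<le> F" by (simp add: generated_def)
    fix t
    have "eventually (\<lambda>x. x \<in> U t) (generated F (range U))"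
      unfolding eventually_generated by (intro exI[of _ "{U t}"]) auto
    then show "\<exists>V. R t V \<and> eventually (\<lambda>x. x \<in> V) (generated F (range U))" using main by blast
  qed
qed

text \<open>In the library's order \<open>decseq F\<close> says that the contours increase as
  families of sets. Each is obtained from the one before by \<open>contour_on_refine\<close>, with
  positive ranks as that lemma requires.\<close>

lemma ex_contour_chain:
  assumes "0 < \<gamma>"
  shows "\<exists>a D F. (\<forall>i :: nat. contour_on (a i) (D i) (F i)) \<and> decseq F \<and> (\<forall>i. a i < \<gamma>) \<and>
    (\<forall>\<beta><\<gamma>. \<exists>i. \<beta> \<le> a i)"
proof (cases "\<exists>\<delta><\<gamma>. \<delta> \<noteq> 0")
  case False
  \<comment> \<open>For \<open>\<gamma> = 1\<close> only rank 0 lies below \<open>\<gamma>\<close>.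
    The chain is constant, and the ultrafilter built over it is the principal one at 0.\<close>
  then have "(\<forall>i :: nat. contour_on 0 {0} (principal {0})) \<and> decseq (\<lambda>_ :: nat. principal {0 :: nat}) \<and>
      (\<forall>i :: nat. 0 < \<gamma>) \<and> (\<forall>\<beta><\<gamma>. \<exists>i :: nat. \<beta> \<le> 0)"
    using assms contour_on.point by (auto simp: decseq_def)
  then show ?thesis by (intro exI[of _ "\<lambda>_. 0"] exI[of _ "\<lambda>_. {0}"] exI[of _ "\<lambda>_. principal {0}"])
next
  case True
  then obtain \<delta> where \<delta>: "\<delta> < \<gamma>" "0 < \<delta>" using zero_less_omega1 by blast
  obtain d where d: "least_strict_bound d \<gamma>" using ex_least_strict_bound[OF assms] by blast
  define a where "a n = max \<delta> (d n)" for n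
  have a: "least_strict_bound a \<gamma>"
    using least_strict_bound_max[OF d, of "\<lambda>_. \<delta>"] \<delta> by (simp add: mono_def a_def[abs_def])
  have pos: "0 < a n" for n using \<delta> by (simp add: a_def less_max_iff_disj)
  have "\<exists>f. \<forall>n :: nat. contour_on (a n) (fst (f n)) (snd (f n)) \<and> snd (f (Suc n)) \<le> snd (f n)"
  proof (rule dependent_nat_choice)
    show "\<exists>p. contour_on (a 0) (fst p) (snd p)"
      using ex_contour_on[OF infinite_UNIV_nat pos[of 0]] by auto
    fix p :: "nat set \<times> nat filter" and n
    assume "contour_on (a n) (fst p) (snd p)"
    from contour_on_refine[OF this pos, of "a (Suc n)"]
    show "\<exists>q. contour_on (a (Suc n)) (fst q) (snd q) \<and> snd q \<le> snd p"
      using least_strict_boundD(1)[OF a] by (force simp: mono_def)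
  qed
  then obtain f where "\<forall>n :: nat. contour_on (a n) (fst (f n)) (snd (f n)) \<and> snd (f (Suc n)) \<le> snd (f n)" ..
  then show ?thesis
    using least_strict_boundD[OF a]
    by (intro exI[of _ a] exI[of _ "\<lambda>n. fst (f n)"] exI[of _ "\<lambda>n. snd (f n)"]) (auto simp: decseq_Suc_iff)
qed

section \<open>Adding a set with thin image, and a set that avoids a contour\<close>

text \<open>If \<open>f\<close> maps some positive set into a finite \<open>M\<close>, the preimage
  of \<open>M\<close> is added. Otherwise \<open>countable_test_family\<close> applies to every pair
  \<open>(B, i)\<close>; the test sets together are fewer than \<open>2\<^sup>\<omega>\<close>, and
  the preimage of a thin \<open>Z\<close> that meets each of them infinitely often is
  positive.\<close>

lemma thin_image_step:
  fixes f :: "nat \<Rightarrow> nat"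
  assumes "martins_axiom" and F: "\<And>i. contour_on (a i) (D i) (F i)" and "decseq F"
    and \<B>: "small \<B>" "generated (INF i. F i) \<B> \<noteq> bot"
  shows "\<exists>U. f ` U \<in> thin_ideal \<and> generated (INF i. F i) (insert U \<B>) \<noteq> bot"
proof (cases "\<exists>M. finite M \<and> (\<exists>\<^sub>F x in generated (INF i. F i) \<B>. f x \<in> M)")
  case True
  then obtain M where M: "finite M" "\<exists>\<^sub>F x in generated (INF i. F i) \<B>. x \<in> f -` M" by auto
  have "finite (f ` (f -` M))" by (rule finite_subset[OF _ M(1)]) auto
  then have "f ` (f -` M) \<in> thin_ideal" by (rule finite_mem_thin_ideal)
  moreover have "generated (INF i. F i) (insert (f -` M) \<B>) \<noteq> bot"
    using M(2) by (simp only: generated_insert_neq_bot)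
  ultimately show ?thesis by blast
next
  case False
  define I where "I = {\<Inter>\<C> | \<C>. finite \<C> \<and> \<C> \<subseteq> \<B>}"
  have "\<exists>\<^sub>F x in generated (INF i. F i) \<B>. f x \<notin> M" if M: "finite M" for M
  proof -
    have "eventually (\<lambda>x. f x \<notin> M) (generated (INF i. F i) \<B>)"
      using False M by (simp add: frequently_def)
    then show ?thesis by (rule eventually_frequently[OF \<B>(2)])
  qed
  then have fr: "\<exists>\<^sub>F x in F i. x \<in> B \<and> f x \<notin> M" if "finite M" "B \<in> I" for M B i
    using that unfolding frequently_generated_INF[OF \<open>decseq F\<close>] I_def by blast
  define test where "test B i \<E> \<longleftrightarrow> countable \<E> \<and> (\<forall>E\<in>\<E>. infinite E) \<and>
    (\<forall>Z. (\<forall>E\<in>\<E>. infinite (Z \<inter> E)) \<longrightarrow> (\<exists>\<^sub>F x in F i. x \<in> B \<and> f x \<in> Z))" for B i \<E>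
  define \<E> where "\<E> B i = (SOME \<E>. test B i \<E>)" for B i
  have \<E>: "test B i (\<E> B i)" if "B \<in> I" for B i
    unfolding \<E>_def using countable_test_family[OF F fr[OF _ that]]
    by (intro someI_ex[of "test B i"]) (simp add: test_def)
  have "small (\<Union>p\<in>I \<times> UNIV. case p of (B, i) \<Rightarrow> \<E> B i)"
  proof (rule small_UN_countable)
    show "small (I \<times> (UNIV :: nat set))"
      unfolding I_def by (intro small_Times small_finite_Inter \<B>(1) small_countable) simp
  qed (use \<E> in \<open>auto simp: test_def\<close>)
  moreover have "infinite E" if "E \<in> (\<Union>p\<in>I \<times> UNIV. case p of (B, i) \<Rightarrow> \<E> B i)" for E
    using that \<E> unfolding test_def by fast
  ultimately obtain Z where Z: "thin Z" "\<forall>E\<in>(\<Union>p\<in>I \<times> UNIV. case p of (B, i) \<Rightarrow> \<E> B i). infinite (Z \<inter> E)"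
    using martins_axiom_thin[OF assms(1)] by blast
  have "\<exists>\<^sub>F x in F i. x \<in> B \<and> x \<in> f -` Z" if "B \<in> I" for B i
    using \<E>[OF that, of i] Z(2) that unfolding test_def by fastforce
  then have "\<exists>\<^sub>F x in generated (INF i. F i) \<B>. x \<in> f -` Z"
    unfolding frequently_generated_INF[OF \<open>decseq F\<close>] I_def by blast
  moreover have "f ` (f -` Z) \<in> thin_ideal"
    by (rule thin_ideal_subset[OF thin_mem_thin_ideal[OF Z(1)]]) auto
  ultimately show ?thesis by (intro exI[of _ "f -` Z"]) (simp only: generated_insert_neq_bot)
qed

text \<open>If no such \<open>U\<close> exists, \<open>G\<close> is contained in the filter
  generated so far. Then \<open>escape\<close> gives a sequence of sets for every pair
  \<open>(B, i)\<close>; coded by functions, these sequences are dominated by one \<open>d\<close>.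
  The set of \<open>G\<close> determined by \<open>d\<close> has a complement that is positive on
  every \<open>B\<close> for every \<open>F i\<close>, a contradiction.\<close>

lemma contour_avoiding_step:
  assumes "martins_axiom" and F: "\<And>i. contour_on (a i) (D i) (F i)" and "decseq F"
    and \<B>: "small \<B>" "generated (INF i. F i) \<B> \<noteq> bot"
    and a: "\<And>i. a i < \<gamma>" and "contour_on \<gamma> E G"
  shows "\<exists>U. eventually (\<lambda>x. x \<notin> U) G \<and> generated (INF i. F i) (insert U \<B>) \<noteq> bot"
proof (rule ccontr)
  define H where "H = generated (INF i. F i) \<B>"
  assume "\<not> ?thesis"
  then have "\<forall>U. eventually (\<lambda>x. x \<notin> U) G \<longrightarrow> \<not> (\<exists>\<^sub>F x in H. x \<in> U)"
    unfolding generated_insert_neq_bot H_def by blast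
  from this[rule_format, of "- _"]
  have no: "\<not> (\<exists>\<^sub>F x in H. x \<in> - A)" if "eventually (\<lambda>x. x \<in> A) G" for A
    using that by simp
  then have GH: "eventually (\<lambda>x. x \<in> A) H" if "eventually (\<lambda>x. x \<in> A) G" for A
    using no[OF that] by (simp add: frequently_def)
  define I where "I = {\<Inter>\<C> | \<C>. finite \<C> \<and> \<C> \<subseteq> \<B>}"
  have "0 < \<gamma>" using a zero_le_omega1 le_less_trans by blast
  obtain b E' G' where G': "\<And>k. contour_on (b k) (E' k) (G' k)" and E': "disjoint_family E'"
    and b: "least_strict_bound b \<gamma>" and G: "G = filter_integral sequentially G'"
    using contour_on_posE[OF \<open>contour_on \<gamma> E G\<close> \<open>0 < \<gamma>\<close>] by metis
  \<comment> \<open>Finitely many pieces are null for \<open>G\<close>, so their complement belongs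
    to \<open>H\<close> and is positive on each \<open>B\<close>.\<close>
  have pos: "\<exists>\<^sub>F x in F i. x \<in> B - (\<Union>k<K. E' k)" if B: "B \<in> I" for B i K
  proof -
    have "eventually (\<lambda>x. x \<in> - (\<Union>k<K. E' k)) (G' j)" if "j \<ge> K" for j
      using contour_on_eventually[OF G'[of j]]
    proof (rule eventually_mono)
      fix x assume "x \<in> E' j"
      moreover have "E' j \<inter> E' k = {}" if "k < K" for k
        using disjoint_family_onD[OF E', of j k] that \<open>j \<ge> K\<close> by auto
      ultimately show "x \<in> - (\<Union>k<K. E' k)" by blast
    qed
    then have "eventually (\<lambda>x. x \<in> - (\<Union>k<K. E' k)) G"
      unfolding G eventually_filter_integral eventually_sequentially by blast
    then have "\<exists>\<^sub>F x in H. x \<in> - (\<Union>k<K. E' k)"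
      using eventually_frequently GH \<B>(2) unfolding H_def by blast
    then show ?thesis
      using B unfolding H_def frequently_generated_INF[OF \<open>decseq F\<close>] I_def[symmetric] by auto
  qed
  define bound where "bound B i A \<longleftrightarrow> (\<forall>k. eventually (\<lambda>x. x \<in> A k) (G' k)) \<and>
    (\<forall>A'. (\<forall>k. A' k \<subseteq> E' k) \<and> (\<exists>m. \<forall>k\<ge>m. A' k \<subseteq> A k) \<longrightarrow>
      (\<exists>\<^sub>F x in F i. x \<in> B - (\<Union>k. A' k)))" for B i A
  have ex_bound: "\<exists>A. bound B i A" if "B \<in> I" for B i
    unfolding bound_def by (rule escape[OF F G' E' b a pos[OF that]])
  have "\<forall>k. \<exists>\<Phi> :: (nat \<Rightarrow> nat) \<Rightarrow> nat set. (\<forall>g. eventually (\<lambda>x. x \<in> \<Phi> g) (G' k)) \<and>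
      (\<forall>g h. g \<le> h \<longrightarrow> \<Phi> h \<subseteq> \<Phi> g) \<and> (\<forall>A. eventually (\<lambda>x. x \<in> A) (G' k) \<longrightarrow> (\<exists>g. \<Phi> g \<subseteq> A))"
    using contour_on_monotone_base[OF G'] by blast
  then obtain \<Phi> :: "nat \<Rightarrow> (nat \<Rightarrow> nat) \<Rightarrow> nat set"
    where \<Phi>: "\<forall>k. (\<forall>g. eventually (\<lambda>x. x \<in> \<Phi> k g) (G' k)) \<and>
      (\<forall>g h. g \<le> h \<longrightarrow> \<Phi> k h \<subseteq> \<Phi> k g) \<and> (\<forall>A. eventually (\<lambda>x. x \<in> A) (G' k) \<longrightarrow> (\<exists>g. \<Phi> k g \<subseteq> A))"
    by (rule choice[THEN exE])
  \<comment> \<open>Joins the parameters of all pieces into one function, so that a single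
    \<open>d\<close> handles all pieces simultaneously.\<close>
  define code where "code g = (\<lambda>n. case prod_decode n of (k, j) \<Rightarrow> g k j)"
    for g :: "nat \<Rightarrow> nat \<Rightarrow> nat"
  define good where "good B i g \<longleftrightarrow> (\<exists>A. bound B i A \<and> (\<forall>k. \<Phi> k (\<lambda>j. g (prod_encode (k, j))) \<subseteq> A k))"
    for B i g
  have good: "\<exists>g. good B i g" if B: "B \<in> I" for B i
  proof -
    obtain A where A: "bound B i A" using ex_bound[OF B] by blast
    have "\<forall>k. \<exists>g. \<Phi> k g \<subseteq> A k" using A \<Phi> unfolding bound_def by blast
    then obtain g where "\<forall>k. \<Phi> k (g k) \<subseteq> A k" by (rule choice[THEN exE])
    then have "good B i (code g)" unfolding good_def using A by (intro exI[of _ A]) (simp add: code_def)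
    then show ?thesis by blast
  qed
  define g where "g B i = (SOME g. good B i g)" for B i
  have "small ((\<lambda>(B, i). g B i) ` (I \<times> UNIV))"
    unfolding I_def by (intro small_image small_Times small_finite_Inter \<B>(1) small_countable) simp
  from martins_axiom_dominating[OF assms(1) this] obtain d
    where dom: "\<forall>f\<in>(\<lambda>(B, i). g B i) ` (I \<times> UNIV). \<exists>m. \<forall>n\<ge>m. f n \<le> d n" by (rule exE)
  have d: "\<exists>m. \<forall>n\<ge>m. g B i n \<le> d n" if "B \<in> I" for B i
    by (rule bspec[OF dom]) (use that in force)
  define A where "A k = \<Phi> k (\<lambda>j. d (prod_encode (k, j))) \<inter> E' k" for k
  have "eventually (\<lambda>x. x \<in> (\<Union>k. A k)) (G' k)" for k
  proof -
    have "eventually (\<lambda>x. x \<in> \<Phi> k (\<lambda>j. d (prod_encode (k, j)))) (G' k)" using \<Phi> by blast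
    with contour_on_eventually[OF G'[of k]] show ?thesis
      by eventually_elim (auto simp: A_def)
  qed
  then have "eventually (\<lambda>x. x \<in> (\<Union>k. A k)) G" unfolding G eventually_filter_integral by simp
  then have "\<not> (\<exists>\<^sub>F x in H. x \<in> - (\<Union>k. A k))" by (rule no)
  then obtain B i where B: "B \<in> I" "\<not> (\<exists>\<^sub>F x in F i. x \<in> B \<and> x \<in> - (\<Union>k. A k))"
    unfolding H_def frequently_generated_INF[OF \<open>decseq F\<close>] I_def[symmetric] by blast
  have "good B i (g B i)" unfolding g_def using good[OF B(1)] by (rule someI_ex)
  then obtain C where C: "bound B i C" "\<And>k. \<Phi> k (\<lambda>j. g B i (prod_encode (k, j))) \<subseteq> C k"
    unfolding good_def by blast
  obtain m where m: "\<And>n. n \<ge> m \<Longrightarrow> g B i n \<le> d n" using d[OF B(1)] by blast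
  have "A k \<subseteq> C k" if "k \<ge> m" for k
  proof -
    \<comment> \<open>Since \<open>prod_encode (k, j)\<close> is at least \<open>k\<close>, block
      \<open>k\<close> lies entirely in the range of domination once \<open>k \<ge> m\<close>.
      Eventual domination thus becomes domination everywhere on almost all blocks.\<close>
    have "(\<lambda>j. g B i (prod_encode (k, j))) \<le> (\<lambda>j. d (prod_encode (k, j)))"
      using m that le_prod_encode_1[of k] order_trans unfolding le_fun_def by blast
    then have "\<Phi> k (\<lambda>j. d (prod_encode (k, j))) \<subseteq> \<Phi> k (\<lambda>j. g B i (prod_encode (k, j)))"
      using \<Phi> by blast
    then show ?thesis using C(2)[of k] unfolding A_def by blast
  qed
  moreover have "\<forall>k. A k \<subseteq> E' k" by (simp add: A_def)
  ultimately have "\<exists>\<^sub>F x in F i. x \<in> B - (\<Union>k. A k)" using C(1) unfolding bound_def by blast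
  then show False using B(2) by simp
qed

section \<open>Construction of the ultrafilter\<close>

text \<open>A task is a triple \<open>(A, f, c)\<close>: decide \<open>A\<close>, make the image
  under \<open>f\<close> thin, and exclude the contour \<open>\<G> c\<close>. Containing contours of
  all smaller positive ranks comes from the base filter through
  \<open>contour_on_coarsen\<close>.\<close>

lemma ex_thin_ultrafilter_avoiding:
  fixes \<G> :: "'c \<Rightarrow> nat filter" and h :: "'c \<Rightarrow> nat set"
  assumes "martins_axiom" "0 < \<gamma>" "inj h" "\<And>c. \<exists>E. contour_on \<gamma> E (\<G> c)"
  shows "\<exists>u. ideal_ultrafilter thin_ideal u \<and> (\<forall>c. \<not> u \<le> \<G> c) \<and>
    (\<forall>\<beta>. 0 < \<beta> \<and> \<beta> < \<gamma> \<longrightarrow> (\<exists>D F. contour_on \<beta> D F \<and> u \<le> F))"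
proof -
  obtain a D F where F: "\<forall>i :: nat. contour_on (a i) (D i) (F i)" and dec: "decseq F"
    and a: "\<forall>i. a i < \<gamma>" and cof: "\<forall>\<beta><\<gamma>. \<exists>i. \<beta> \<le> a i"
    using ex_contour_chain[OF assms(2)] by (elim exE conjE)
  define F0 where "F0 = (INF i. F i)"
  define R where "R = (\<lambda>(A, f :: nat \<Rightarrow> nat, c) U. (U \<subseteq> A \<or> U \<subseteq> - A) \<and> f ` U \<in> thin_ideal \<and>
    eventually (\<lambda>x. x \<notin> U) (\<G> c))"
  \<comment> \<open>The tags 0, 1, 2 keep the three components apart, so that triples are coded
    injectively by sets of numbers.\<close>
  define e where "e = (\<lambda>(A, f :: nat \<Rightarrow> nat, c). (\<lambda>n. prod_encode (0, n)) ` A \<union>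
    range (\<lambda>n. prod_encode (1, prod_encode (n, f n))) \<union> (\<lambda>n. prod_encode (2, n)) ` h c)"
  have "inj e"
  proof (rule injI, simp only: split_paired_all)
    fix A A' and f f' :: "nat \<Rightarrow> nat" and c c' assume eq: "e (A, f, c) = e (A', f', c')"
    have 0: "n \<in> A \<longleftrightarrow> prod_encode (0, n) \<in> e (A, f, c)"
      and 1: "m = f n \<longleftrightarrow> prod_encode (1, prod_encode (n, m)) \<in> e (A, f, c)"
      and 2: "n \<in> h c \<longleftrightarrow> prod_encode (2, n) \<in> e (A, f, c)" for A f c m n
      unfolding e_def by auto
    have "A = A'" using 0[of _ A f c] 0[of _ A' f' c'] eq by blast
    moreover have "f = f'" using 1[of _ f _ A c] 1[of _ f' _ A' c'] eq by (intro ext) metis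
    moreover have "h c = h c'" using 2[of _ c A f] 2[of _ c' A' f'] eq by blast
    ultimately show "(A, f, c) = (A', f', c')" using injD[OF assms(3)] by blast
  qed
  moreover have "F0 \<noteq> bot"
    using contour_on_neq_bot F unfolding trivial_limit_def F0_def eventually_INF_decseq[OF dec] by blast
  moreover have "\<exists>U. R t U \<and> generated F0 (insert U \<B>) \<noteq> bot"
    if \<B>: "small \<B>" "generated F0 \<B> \<noteq> bot" for t \<B>
  proof -
    obtain A f c where t: "t = (A, f, c)" by (cases t)
    have sm: "small (insert U \<B>)" if "small \<B>" for U and \<B> :: "nat set set"
      using small_Un[OF small_countable[of "{U}"] that] by simp
    have "\<exists>U0. (U0 = A \<or> U0 = - A) \<and> generated F0 (insert U0 \<B>) \<noteq> bot"
    proof (cases "\<exists>\<^sub>F x in generated F0 \<B>. x \<in> A")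
      case False
      then have "\<exists>\<^sub>F x in generated F0 \<B>. x \<in> - A"
        using \<B>(2) by (auto simp: not_frequently intro: eventually_frequently)
      then show ?thesis unfolding generated_insert_neq_bot by blast
    qed (auto simp: generated_insert_neq_bot)
    then obtain U0 where U0: "U0 = A \<or> U0 = - A" "generated F0 (insert U0 \<B>) \<noteq> bot" by blast
    obtain U1 where U1: "f ` U1 \<in> thin_ideal" "generated F0 (insert U1 (insert U0 \<B>)) \<noteq> bot"
      using thin_image_step[OF assms(1) F[rule_format] dec sm[OF \<B>(1)], of U0 f] U0(2) unfolding F0_def by blast
    obtain E where E: "contour_on \<gamma> E (\<G> c)" using assms(4) by blast
    obtain U2 where U2: "eventually (\<lambda>x. x \<notin> U2) (\<G> c)"
      "generated F0 (insert U2 (insert U1 (insert U0 \<B>))) \<noteq> bot"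
      using contour_avoiding_step[OF assms(1) F[rule_format] dec sm[OF sm[OF \<B>(1)]] _ a[rule_format] E, of U1 U0] U1(2)
      unfolding F0_def by blast
    have "f ` (U0 \<inter> U1 \<inter> U2) \<subseteq> f ` U1" by blast
    then have "f ` (U0 \<inter> U1 \<inter> U2) \<in> thin_ideal"
      by (rule thin_ideal_subset[OF U1(1)])
    moreover have "eventually (\<lambda>x. x \<notin> U0 \<inter> U1 \<inter> U2) (\<G> c)"
      using U2(1) by (rule eventually_mono) blast
    ultimately have "R t (U0 \<inter> U1 \<inter> U2)" using U0(1) unfolding R_def t by blast
    \<comment> \<open>Adding the three sets one after another is the same as adding their
      intersection, the one set that the task calls for.\<close>
    moreover have "generated F0 (insert (U0 \<inter> U1 \<inter> U2) \<B>) =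
        generated F0 (insert U2 (insert U1 (insert U0 \<B>)))"
      by (simp add: generated_insert inf_assoc Int_assoc Int_commute Int_left_commute)
    ultimately show ?thesis using U2(2) by metis
  qed
  ultimately obtain u where u: "u \<noteq> bot" "u \<le> F0" "\<forall>t. \<exists>U. R t U \<and> eventually (\<lambda>x. x \<in> U) u"
    using ex_generic_filter[of e F0 R] by blast
  have R: "\<exists>U. (U \<subseteq> A \<or> U \<subseteq> - A) \<and> f ` U \<in> thin_ideal \<and> eventually (\<lambda>x. x \<notin> U) (\<G> c) \<and>
      eventually (\<lambda>x. x \<in> U) u" for A f c
    using u(3)[rule_format, of "(A, f, c)"] unfolding R_def by auto
  have "ultrafilter u"
    unfolding ultrafilter_def
  proof (intro conjI allI)
    fix A
    obtain U where U: "U \<subseteq> A \<or> U \<subseteq> - A" "eventually (\<lambda>x. x \<in> U) u" using R by blast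
    have "eventually (\<lambda>x. x \<in> B) u" if "U \<subseteq> B" for B
      using U(2) by (rule eventually_mono) (use that in blast)
    then show "eventually (\<lambda>x. x \<in> A) u \<or> eventually (\<lambda>x. x \<in> - A) u"
      using U(1) by blast
  qed fact
  then have "ideal_ultrafilter thin_ideal u" unfolding ideal_ultrafilter_def using R by blast
  moreover have "\<not> u \<le> \<G> c" for c
  proof
    assume le: "u \<le> \<G> c"
    obtain U where U: "eventually (\<lambda>x. x \<notin> U) (\<G> c)" "eventually (\<lambda>x. x \<in> U) u" using R by blast
    have "eventually (\<lambda>x. x \<notin> U) u" using U(1) le by (simp add: le_filter_def)
    with U(2) have "eventually (\<lambda>_. False) u" by eventually_elim simp
    then show False using u(1) by (simp add: trivial_limit_def)
  qed
  moreover have "\<exists>D F. contour_on \<beta> D F \<and> u \<le> F" if \<beta>: "0 < \<beta>" "\<beta> < \<gamma>" for \<beta>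
  proof -
    obtain i where "\<beta> \<le> a i" using cof \<beta>(2) by blast
    then obtain D' F' where "contour_on \<beta> D' F'" "F i \<le> F'"
      using contour_on_coarsen[OF F[rule_format] \<beta>(1)] by blast
    moreover have "u \<le> F i" using u(2) unfolding F0_def by (meson INF_lower UNIV_I order_trans)
    ultimately show ?thesis using order_trans by blast
  qed
  ultimately show ?thesis by blast
qed

theorem theorem3p1:
  fixes \<gamma> :: omega1
  assumes "martins_axiom"
    and "0 < \<gamma>"
  shows "\<exists>u :: nat filter. ideal_ultrafilter thin_ideal u \<and> u \<in> P_class \<gamma>"
proof -
  obtain G0 where G0: "contour_on \<gamma> UNIV G0" using ex_contour_on[OF infinite_UNIV_nat assms(2)] by blast
  define valid where "valid r \<phi> \<longleftrightarrow> cascade r \<and> monotone_cascade r \<and> cascade_rank r = \<gamma> \<and> inj_on \<phi> (max_nodes r)"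
    for r :: "nat rel" and \<phi> :: "nat \<Rightarrow> nat"
  \<comment> \<open>All contours to be avoided are indexed by pairs \<open>(r, \<phi>)\<close>.
    Pairs that yield none receive the default \<open>G0\<close>, so that every index carries a
    contour of rank \<open>\<gamma>\<close>.\<close>
  define \<G> where "\<G> = (\<lambda>(r, \<phi>). if valid r \<phi> then filtermap \<phi> (contour r) else G0)"
  \<comment> \<open>Relations on numbers and functions between numbers are coded by sets of numbers,
    so at most \<open>2\<^sup>\<omega>\<close> contours have to be avoided.\<close>
  define h where "h = (\<lambda>(r :: nat rel, \<phi> :: nat \<Rightarrow> nat). (\<lambda>p. prod_encode (0, prod_encode p)) ` r \<union>
    range (\<lambda>n. prod_encode (1, prod_encode (n, \<phi> n))))"
  have "inj h"
  proof (rule injI, simp only: split_paired_all)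
    fix r r' :: "nat rel" and \<phi> \<phi>' :: "nat \<Rightarrow> nat" assume eq: "h (r, \<phi>) = h (r', \<phi>')"
    have 0: "p \<in> r \<longleftrightarrow> prod_encode (0, prod_encode p) \<in> h (r, \<phi>)"
      and 1: "m = \<phi> n \<longleftrightarrow> prod_encode (1, prod_encode (n, m)) \<in> h (r, \<phi>)" for r \<phi> p m n
      unfolding h_def by auto
    have "r = r'" using 0[of _ r \<phi>] 0[of _ r' \<phi>'] eq by blast
    moreover have "\<phi> = \<phi>'" using 1[of _ \<phi> _ r] 1[of _ \<phi>' _ r'] eq by (intro ext) metis
    ultimately show "(r, \<phi>) = (r', \<phi>')" by simp
  qed
  moreover have "\<exists>E. contour_on \<gamma> E (\<G> c)" for c
  proof (cases c)
    case (Pair r \<phi>)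
    show ?thesis
    proof (cases "valid r \<phi>")
      case True
      then show ?thesis using contour_on_contour[of r \<phi>] by (simp add: Pair \<G>_def valid_def)
    next
      case False
      then show ?thesis using G0 by (auto simp: Pair \<G>_def)
    qed
  qed
  ultimately obtain u where u: "ideal_ultrafilter thin_ideal u" and avoid: "\<forall>c. \<not> u \<le> \<G> c"
    and contain: "\<forall>\<beta>. 0 < \<beta> \<and> \<beta> < \<gamma> \<longrightarrow> (\<exists>D F. contour_on \<beta> D F \<and> u \<le> F)"
    using ex_thin_ultrafilter_avoiding[OF assms, of h \<G>] by blast
  have "\<not> u \<le> F" if F: "monotone_sequential_contour \<gamma> F" for F
  proof -
    obtain r \<phi> where "valid r \<phi>" "F = filtermap \<phi> (contour r)"
      using F unfolding monotone_sequential_contour_def valid_def by blast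
    then show ?thesis using avoid[rule_format, of "(r, \<phi>)"] by (simp add: \<G>_def)
  qed
  moreover have "\<exists>F. monotone_sequential_contour \<beta> F \<and> u \<le> F" if "0 < \<beta> \<and> \<beta> < \<gamma>" for \<beta>
    using contain that monotone_sequential_contour_of_contour_on by blast
  ultimately have "u \<in> P_class \<gamma>"
    using u unfolding P_class_def ideal_ultrafilter_def by blast
  then show ?thesis using u by blast
qed

end
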